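(* Let $\mathcal{A}$ be a nonnegative integer $d\times n$ matrix of rank $d$ with $n-d=2$, and suppose that $\mathcal{A}$ is normal. Then there exists a term order $\prec$ on $K[x_1,\ldots,x_n]$ such that the initial ideal $\mathrm{in}_\prec(I_{\mathcal{A}})$ of the toric ideal $I_{\mathcal{A}}$ is generated by squarefree monomials, and such that the reduced Gröbner basis of $I_{\mathcal{A}}$ with respect to $\prec$ is a minimal generating set of $I_{\mathcal{A}}$.
   Context: Let $K$ be a field and let $a_1,\ldots,a_n\in\mathbb{Z}^d$ be the columns of $\mathcal{A}$. The toric ideal of $\mathcal{A}$ is $I_{\mathcal{A}}=\langle x^p-x^q : p,q\in\mathbb{N}^n,\ \mathcal{A}p=\mathcal{A}q\rangle\subset K[x_1,\ldots,x_n]$, where $x^p=x_1^{p_1}\cdots x_n^{p_n}$; its codimension is $n-d$. Write $C(\mathcal{A})=\{\sum_i r_i a_i : r_i\in\mathbb{R}_{\ge 0}\}$, $\mathbb{Z}\mathcal{A}=\{\sum_i m_i a_i : m_i\in\mathbb{Z}\}$ and $\mathbb{N}\mathcal{A}=\{\sum_i m_i a_i : m_i\in\mathbb{Z}_{\ge 0}\}$. The matrix $\mathcal{A}$ (and the ideal $I_{\mathcal{A}}$) is called normal if $C(\mathcal{A})\cap\mathbb{Z}\mathcal{A}=\mathbb{N}\mathcal{A}$. *)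

theory Defs
  imports "HOL-Analysis.Analysis" "HOL-Library.Poly_Mapping"
begin

text \<open>
  The polynomial ring over \<open>'k\<close> in variables indexed by the finite type \<open>'n\<close>: a monomial is its
  exponent vector, a polynomial maps finitely many monomials to nonzero coefficients. The ring
  structure is the one of \<^theory>\<open>HOL-Library.Poly_Mapping\<close>.
\<close>

type_synonym 'n monomial = "'n \<Rightarrow>\<^sub>0 nat"
type_synonym ('n, 'k) mpoly = "'n monomial \<Rightarrow>\<^sub>0 'k"

abbreviation exponent :: "'n monomial \<Rightarrow> 'n \<Rightarrow> nat" where
  "exponent \<equiv> Poly_Mapping.lookup"

definition xpow :: "'n monomial \<Rightarrow> ('n, 'k::field) mpoly" where
  "xpow t = Poly_Mapping.single t 1"

definition monomial_dvd :: "'n monomial \<Rightarrow> 'n monomial \<Rightarrow> bool" where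
  "monomial_dvd s t \<longleftrightarrow> (\<exists>u. t = s + u)"

definition squarefree_monomial :: "'n monomial \<Rightarrow> bool" where
  "squarefree_monomial t \<longleftrightarrow> (\<forall>i. exponent t i \<le> 1)"


text \<open>Ideals are submodules of the ring, regarded as a module over itself.\<close>

definition ideal_gen :: "'a::comm_ring_1 set \<Rightarrow> 'a set" where
  "ideal_gen = module.span (*)"

lemma module_mult: "module ((*) :: 'a::comm_ring_1 \<Rightarrow> 'a \<Rightarrow> 'a)"
  by unfold_locales (simp_all add: algebra_simps)

definition minimal_generating_set :: "'a::comm_ring_1 set \<Rightarrow> 'a set \<Rightarrow> bool" where
  "minimal_generating_set G I \<longleftrightarrow> ideal_gen G = I \<and> (\<forall>H. H \<subset> G \<longrightarrow> ideal_gen H \<noteq> I)"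


text \<open>
  Well-foundedness is not demanded separately: for finitely many variables it follows from
  the minimality of the monomial 1 (the exponent vector 0) by Dickson's lemma.
\<close>

definition term_order :: "('n monomial \<Rightarrow> 'n monomial \<Rightarrow> bool) \<Rightarrow> bool" where
  "term_order le \<longleftrightarrow>
     class.linorder le (\<lambda>s t. le s t \<and> s \<noteq> t) \<and>
     (\<forall>t. le 0 t) \<and>
     (\<forall>s t u. le s t \<longrightarrow> le (s + u) (t + u))"

text \<open>The leading monomial and leading coefficient are only meaningful for nonzero polynomials.\<close>

definition lead_monomial ::
    "('n monomial \<Rightarrow> 'n monomial \<Rightarrow> bool) \<Rightarrow> ('n, 'k::field) mpoly \<Rightarrow> 'n monomial" where
  "lead_monomial le f =
     (THE t. t \<in> Poly_Mapping.keys f \<and> (\<forall>s \<in> Poly_Mapping.keys f. le s t))"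

definition lead_coefficient ::
    "('n monomial \<Rightarrow> 'n monomial \<Rightarrow> bool) \<Rightarrow> ('n, 'k::field) mpoly \<Rightarrow> 'k" where
  "lead_coefficient le f = Poly_Mapping.lookup f (lead_monomial le f)"

definition initial_ideal ::
    "('n monomial \<Rightarrow> 'n monomial \<Rightarrow> bool) \<Rightarrow> ('n, 'k::field) mpoly set \<Rightarrow> ('n, 'k) mpoly set" where
  "initial_ideal le I = ideal_gen {xpow (lead_monomial le f) | f. f \<in> I \<and> f \<noteq> 0}"

definition groebner_basis ::
    "('n monomial \<Rightarrow> 'n monomial \<Rightarrow> bool) \<Rightarrow> ('n, 'k::field) mpoly set \<Rightarrow>
     ('n, 'k) mpoly set \<Rightarrow> bool" where
  "groebner_basis le I G \<longleftrightarrow>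
     finite G \<and> G \<subseteq> I \<and> 0 \<notin> G \<and>
     initial_ideal le I = ideal_gen {xpow (lead_monomial le g) | g. g \<in> G}"

definition reduced_groebner_basis ::
    "('n monomial \<Rightarrow> 'n monomial \<Rightarrow> bool) \<Rightarrow> ('n, 'k::field) mpoly set \<Rightarrow>
     ('n, 'k) mpoly set \<Rightarrow> bool" where
  "reduced_groebner_basis le I G \<longleftrightarrow>
     groebner_basis le I G \<and>
     (\<forall>g\<in>G. lead_coefficient le g = 1) \<and>
     (\<forall>g\<in>G. \<forall>h\<in>G. g \<noteq> h \<longrightarrow>
        (\<forall>t \<in> Poly_Mapping.keys h. \<not> monomial_dvd (lead_monomial le g) t))"


definition toric_ideal :: "int^'n^'d \<Rightarrow> ('n::finite, 'k::field) mpoly set" where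
  "toric_ideal A = ideal_gen {xpow p - xpow q | p q.
     A *v (\<chi> j. int (exponent p j)) = A *v (\<chi> j. int (exponent q j))}"

text \<open>
  The columns, and the lattice and semigroup they generate, are regarded inside the real vector
  space in which the cone lives.
\<close>

definition real_column :: "int^'n^'d \<Rightarrow> 'n \<Rightarrow> real^'d" where
  "real_column A j = column j (map_matrix real_of_int A)"

definition column_cone :: "int^'n::finite^'d \<Rightarrow> (real^'d) set" where
  "column_cone A = {\<Sum>j\<in>UNIV. r j *\<^sub>R real_column A j | r. \<forall>j. r j \<ge> 0}"

definition column_lattice :: "int^'n::finite^'d \<Rightarrow> (real^'d) set" where
  "column_lattice A = {\<Sum>j\<in>UNIV. real_of_int (m j) *\<^sub>R real_column A j | m. True}"

definition column_semigroup :: "int^'n::finite^'d \<Rightarrow> (real^'d) set" where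
  "column_semigroup A = {\<Sum>j\<in>UNIV. real_of_int (m j) *\<^sub>R real_column A j | m. \<forall>j. m j \<ge> 0}"

definition normal_matrix :: "int^'n::finite^'d \<Rightarrow> bool" where
  "normal_matrix A \<longleftrightarrow> column_cone A \<inter> column_lattice A = column_semigroup A"

end

theory Submission
  imports Defs
begin

text \<open>
  Let \<open>L\<close> be the lattice of integer relations between the columns; it has rank 2. A basis of \<open>L\<close>
  gives every variable a vector in \<open>\<int>\<^sup>2\<close> (the Gale diagram), and normality says exactly that each
  system \<open>b \<cdot> \<xi> \<le> p b\<close> with one integral inequality for every Gale vector \<open>b\<close> that has a real solution
  has an integral one. Testing this on suitable lattice-free triangles and quadrangles shows that
  the Gale diagram contains vectors \<open>v\<close>, \<open>w\<close> of determinant 1 such that, in the coordinates given by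
  \<open>v\<close> and \<open>w\<close>, all coordinates of all Gale vectors are at most 1 and \<open>(1, 1)\<close> does not occur: the
  cone of \<open>v\<close> and \<open>w\<close> is a chamber whose regular triangulation is unimodular.

  In this basis \<open>F\<close>, \<open>G\<close> of \<open>L\<close>, the binomials of \<open>F\<close>, \<open>G\<close> and \<open>F + G\<close> have squarefree leading
  monomials for every term order that compares first the total degree in the two variables of \<open>v\<close>
  and \<open>w\<close>, and they form a Groebner basis. If all three are needed as leading terms but not as
  generators, moving on to a neighbouring chamber leaves only two binomials.
\<close>

subsection \<open>Planar configurations with the integral feasibility property\<close>

definition det2 :: "int \<times> int \<Rightarrow> int \<times> int \<Rightarrow> int" where
  "det2 a b = fst a * snd b - snd a * fst b"

definition integrally_feasible :: "(int \<times> int) set \<Rightarrow> bool" where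
  "integrally_feasible S \<longleftrightarrow> (\<forall>p :: int \<times> int \<Rightarrow> int.
     (\<exists>s t :: real. \<forall>b\<in>S. of_int (fst b) * s + of_int (snd b) * t \<le> of_int (p b)) \<longrightarrow>
     (\<exists>s t :: int. \<forall>b\<in>S. fst b * s + snd b * t \<le> p b))"

text \<open>Since \<open>det2 v w = 1\<close>, Cramer's rule makes \<open>det2 b w\<close> and
  \<open>det2 v b\<close> the coordinates of \<open>b\<close> in the basis \<open>v\<close>,
  \<open>w\<close>.\<close>

definition frame :: "(int \<times> int) set \<Rightarrow> int \<times> int \<Rightarrow> int \<times> int \<Rightarrow> bool" where
  "frame S v w \<longleftrightarrow> v \<in> S \<and> w \<in> S \<and> det2 v w = 1 \<and>
     (\<forall>b\<in>S. det2 b w \<le> 1 \<and> det2 v b \<le> 1 \<and> \<not> (det2 b w = 1 \<and> det2 v b = 1))"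

definition lin2 :: "int \<Rightarrow> int \<Rightarrow> int \<Rightarrow> int \<Rightarrow> int \<times> int \<Rightarrow> int \<times> int" where
  "lin2 a b c d v = (a * fst v + b * snd v, c * fst v + d * snd v)"

lemma fst_lin2 [simp]: "fst (lin2 a b c d v) = a * fst v + b * snd v"
  and snd_lin2 [simp]: "snd (lin2 a b c d v) = c * fst v + d * snd v"
  by (simp_all add: lin2_def)

lemma det2_lin2: "det2 (lin2 a b c d u) (lin2 a b c d v) = (a * d - b * c) * det2 u v"
  by (simp add: det2_def algebra_simps)

text \<open>A map of determinant -1 reverses orientation, so in that case the two frame vectors
  trade places.\<close>

lemma frame_lin2:
  assumes "\<exists>v w. frame (lin2 a b c d ` S) v w" and "a * d - b * c = 1 \<or> a * d - b * c = -1"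
  shows "\<exists>v w. frame S v w"
proof -
  obtain v w where vw: "v \<in> S" "w \<in> S" "frame (lin2 a b c d ` S) (lin2 a b c d v) (lin2 a b c d w)"
    using assms(1) by (auto simp: frame_def)
  from assms(2) show ?thesis
  proof
    assume d: "a * d - b * c = 1"
    have "frame S v w" using vw unfolding frame_def by (simp add: det2_lin2 d)
    then show ?thesis by blast
  next
    assume d: "a * d - b * c = -1"
    have sw: "det2 u v = - det2 v u" for u v by (simp add: det2_def)
    have "frame S w v"
      unfolding frame_def
    proof (intro conjI ballI)
      show "det2 w v = 1" using vw sw[of w v] by (simp add: frame_def det2_lin2 d)
    next
      fix b assume "b \<in> S"
      then have "- det2 b w \<le> 1" "- det2 v b \<le> 1" "\<not> (- det2 b w = 1 \<and> - det2 v b = 1)"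
        using vw by (simp_all add: frame_def det2_lin2 d)
      then show "det2 b v \<le> 1" "det2 w b \<le> 1" "\<not> (det2 b v = 1 \<and> det2 w b = 1)"
        using sw[of b v] sw[of w b] by auto
    qed (use vw in auto)
    then show ?thesis by blast
  qed
qed

section \<open>Stability of integral feasibility\<close>

lemma integrally_feasibleD:
  fixes s t :: real
  assumes N: "integrally_feasible S"
    and h: "\<And>b. b \<in> S \<Longrightarrow> of_int (fst b) * s + of_int (snd b) * t \<le> of_int (p b)"
  obtains s' t' :: int where "\<And>b. b \<in> S \<Longrightarrow> fst b * s' + snd b * t' \<le> p b"
proof -
  have "\<exists>s t :: real. \<forall>b\<in>S. of_int (fst b) * s + of_int (snd b) * t \<le> of_int (p b)"
    by (rule exI[of _ s], rule exI[of _ t]) (use h in blast)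
  with N[unfolded integrally_feasible_def, rule_format, of p]
  obtain s' t' where "\<forall>b\<in>S. fst b * s' + snd b * t' \<le> p b" by blast
  then show ?thesis by (intro that) blast
qed

lemma integrally_feasible_subset:
  assumes N: "integrally_feasible S" and TS: "T \<subseteq> S"
  shows "integrally_feasible T"
  unfolding integrally_feasible_def
proof (intro allI impI, elim exE)
  fix p :: "int \<times> int \<Rightarrow> int" and s t :: real
  assume h: "\<forall>b\<in>T. of_int (fst b) * s + of_int (snd b) * t \<le> of_int (p b)"
  \<comment> \<open>Vectors outside \<open>T\<close> get as bound the value at the real solution,
    rounded up, so that they do not obstruct it.\<close>
  define q where "q = (\<lambda>b. if b \<in> T then p b else \<lceil>of_int (fst b) * s + of_int (snd b) * t\<rceil>)"
  obtain s' t' where st: "\<And>b. b \<in> S \<Longrightarrow> fst b * s' + snd b * t' \<le> q b"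
  proof (rule integrally_feasibleD[OF N, where p = q and s = s and t = t])
    show "of_int (fst b) * s + of_int (snd b) * t \<le> of_int (q b)" for b
      using h by (simp add: q_def)
  qed blast
  have "fst b * s' + snd b * t' \<le> p b" if "b \<in> T" for b
    using st[of b] that TS by (auto simp: q_def)
  then show "\<exists>s t. \<forall>b\<in>T. fst b * s + snd b * t \<le> p b" by blast
qed

lemma integrally_feasible_lin2:
  assumes N: "integrally_feasible S" and D: "a * d - b * c = 1 \<or> a * d - b * c = -1"
  shows "integrally_feasible (lin2 a b c d ` S)"
  unfolding integrally_feasible_def
proof (intro allI impI, elim exE)
  fix p :: "int \<times> int \<Rightarrow> int" and s t :: real
  assume h: "\<forall>v\<in>lin2 a b c d ` S. of_int (fst v) * s + of_int (snd v) * t \<le> of_int (p v)"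
  obtain s' t' where st: "\<And>v. v \<in> S \<Longrightarrow> fst v * s' + snd v * t' \<le> p (lin2 a b c d v)"
  proof (rule integrally_feasibleD[OF N, where p = "\<lambda>v. p (lin2 a b c d v)"
        and s = "a * s + c * t" and t = "b * s + d * t"])
    fix v assume "v \<in> S"
    then have "of_int (fst (lin2 a b c d v)) * s + of_int (snd (lin2 a b c d v)) * t
        \<le> of_int (p (lin2 a b c d v))"
      using h by blast
    then show "of_int (fst v) * (a * s + c * t) + of_int (snd v) * (b * s + d * t)
        \<le> of_int (p (lin2 a b c d v))"
      by (simp add: algebra_simps)
  qed blast
  define e where "e = a * d - b * c"
  have e: "e * e = 1" using D unfolding e_def by (elim disjE) simp_all
  have "fst (lin2 a b c d v) * (e * (d * s' - c * t')) + snd (lin2 a b c d v) * (e * (a * t' - b * s'))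
      \<le> p (lin2 a b c d v)" if "v \<in> S" for v
  proof -
    have "fst (lin2 a b c d v) * (e * (d * s' - c * t')) + snd (lin2 a b c d v) * (e * (a * t' - b * s'))
      = e * (a * d - b * c) * (fst v * s' + snd v * t')"
      by (simp add: algebra_simps)
    also have "\<dots> = fst v * s' + snd v * t'" using e unfolding e_def by simp
    finally show ?thesis using st[OF that] by simp
  qed
  then show "\<exists>s t. \<forall>v\<in>lin2 a b c d ` S. fst v * s + snd v * t \<le> p v"
    by blast
qed

section \<open>Forbidden triangles, opposite pairs and quadrangles\<close>

text \<open>The three determinants are positive coefficients of a linear relation between
  \<open>a\<close>, \<open>b\<close>, \<open>c\<close>, so the slacks of the three inequalities have
  the same weighted sum at every point. With the bound for \<open>a\<close> rounded up, this sum is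
  below \<open>det2 b c\<close>, which leaves no room for a positive integral slack at
  \<open>b\<close> or \<open>c\<close>.\<close>

lemma lattice_vertex:
  assumes N: "integrally_feasible {a, b, c}" and ge: "det2 b c \<ge> 1"
    and mn: "det2 b c \<le> det2 c a" "det2 b c \<le> det2 a b"
  shows "\<exists>s t. fst b * s + snd b * t = pb \<and> fst c * s + snd c * t = pc"
proof -
  obtain a1 a2 where a: "a = (a1, a2)" by (cases a)
  obtain b1 b2 where b: "b = (b1, b2)" by (cases b)
  obtain c1 c2 where c: "c = (c1, c2)" by (cases c)
  note abc = a b c
  define X Y Z where XYZ: "X = det2 b c" "Y = det2 c a" "Z = det2 a b"
  have X0: "0 < X" and XY: "X \<le> Y" "X \<le> Z" using ge mn by (auto simp: XYZ)
  have X: "X = b1 * c2 - b2 * c1" and Y: "Y = c1 * a2 - c2 * a1" and Z: "Z = a1 * b2 - a2 * b1"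
    by (simp_all add: XYZ abc det2_def)
  have rel1: "X * a1 + Y * b1 + Z * c1 = 0" and rel2: "X * a2 + Y * b2 + Z * c2 = 0"
    by (simp_all add: X Y Z algebra_simps)
  define s t :: real where st: "s = (pb * c2 - pc * b2) / X" "t = (pc * b1 - pb * c1) / X"
  have Xr: "real_of_int X > 0" using X0 by simp
  have sb: "b1 * s + b2 * t = pb"
  proof -
    have "X * (b1 * s + b2 * t) = b1 * (pb * c2 - pc * b2) + b2 * (pc * b1 - pb * c1)"
      using Xr by (simp add: st field_simps)
    also have "\<dots> = X * pb" by (simp add: X algebra_simps)
    finally show ?thesis using Xr by simp
  qed
  have sc: "c1 * s + c2 * t = pc"
  proof -
    have "X * (c1 * s + c2 * t) = c1 * (pb * c2 - pc * b2) + c2 * (pc * b1 - pb * c1)"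
      using Xr by (simp add: st field_simps)
    also have "\<dots> = X * pc" by (simp add: X algebra_simps)
    finally show ?thesis using Xr by simp
  qed
  \<comment> \<open>The third inequality cuts off a triangle too small to contain a lattice point other than the
    vertex \<open>(s, t)\<close>.\<close>
  define pa where "pa = \<lceil>a1 * s + a2 * t\<rceil>"
  have self: "det2 u u = 0" for u by (simp add: det2_def)
  have dist: "a \<noteq> b" "a \<noteq> c" "b \<noteq> c"
    using X0 XY self unfolding XYZ by (metis less_irrefl order.strict_trans2)+
  define p where "p = (\<lambda>v. if v = a then pa else if v = b then pb else pc)"
  obtain s' t' where i: "\<And>v. v \<in> {a, b, c} \<Longrightarrow> fst v * s' + snd v * t' \<le> p v"
    by (rule integrally_feasibleD[OF N, where p = p and s = s and t = t])
       (use sb sc dist in \<open>auto simp: p_def pa_def abc\<close>)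
  define sa sb' sc' where sl: "sa = pa - (a1 * s' + a2 * t')" "sb' = pb - (b1 * s' + b2 * t')"
    "sc' = pc - (c1 * s' + c2 * t')"
  have nn: "sa \<ge> 0" "sb' \<ge> 0" "sc' \<ge> 0"
    using i[of a] i[of b] i[of c] dist by (auto simp: p_def abc sl)
  have tot: "X * sa + Y * sb' + Z * sc' = X * pa + Y * pb + Z * pc"
  proof -
    have "X * sa + Y * sb' + Z * sc' = X * pa + Y * pb + Z * pc
       - (X * a1 + Y * b1 + Z * c1) * s' - (X * a2 + Y * b2 + Z * c2) * t'"
      by (simp add: sl algebra_simps)
    then show ?thesis by (simp only: rel1 rel2 mult_zero_left diff_zero)
  qed
  \<comment> \<open>At the real vertex \<open>b\<close> and \<open>c\<close> have slack 0, so the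
    weighted sum reduces to \<open>X\<close> times the rounding error of \<open>pa\<close>.\<close>
  have "X * (a1 * s + a2 * t) + Y * pb + Z * pc = (X * a1 + Y * b1 + Z * c1) * s + (X * a2 + Y * b2 + Z * c2) * t"
  proof -
    have "Y * real_of_int pb = Y * (b1 * s + b2 * t)" "Z * real_of_int pc = Z * (c1 * s + c2 * t)"
      using sb sc by auto
    then show ?thesis by (simp add: algebra_simps)
  qed
  also have "\<dots> = 0" by (simp only: rel1 rel2 mult_zero_left diff_zero)
  finally have z: "X * (a1 * s + a2 * t) + Y * pb + Z * pc = 0" .
  have "pa < a1 * s + a2 * t + 1" unfolding pa_def by linarith
  then have "X * real_of_int pa < X * (a1 * s + a2 * t + 1)" using Xr by (rule mult_strict_left_mono)
  then have "real_of_int (X * pa + Y * pb + Z * pc) < X" using z by (simp add: algebra_simps)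
  then have lt: "X * sa + Y * sb' + Z * sc' < X" unfolding tot by (simp only: of_int_less_iff)
  have "Y * sb' \<ge> 0" "Z * sc' \<ge> 0" "X * sa \<ge> 0" using nn X0 XY by auto
  then have small: "Y * sb' < X" "Z * sc' < X" using lt by linarith+
  have zero: "k = 0" if "k \<ge> 0" "y * k < X" "X \<le> y" for y k :: int
  proof (rule ccontr)
    assume "k \<noteq> 0"
    then have "1 \<le> k" "0 \<le> y" using that(1,3) X0 by linarith+
    then have "y * 1 \<le> y * k" by (rule mult_left_mono)
    then show False using that(2,3) by linarith
  qed
  have "sb' = 0" "sc' = 0"
    using zero[OF nn(2) small(1) XY(1)] zero[OF nn(3) small(2) XY(2)] .
  then show ?thesis by (auto simp: sl abc)
qed

text \<open>The integral vertices for the right-hand sides (1, 0) and (0, 1) are the columns of an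
  integral inverse of the matrix with rows \<open>b\<close>, \<open>c\<close>; its determinant would
  divide 1.\<close>

lemma no_bad_triple_min:
  assumes N: "integrally_feasible S" and S: "a \<in> S" "b \<in> S" "c \<in> S" and ge: "det2 b c \<ge> 2"
    and mn: "det2 b c \<le> det2 c a" "det2 b c \<le> det2 a b"
  shows False
proof -
  have N': "integrally_feasible {a, b, c}"
    by (rule integrally_feasible_subset[OF N]) (use S in blast)
  have ge1: "det2 b c \<ge> 1" using ge by simp
  obtain s t where 1: "fst b * s + snd b * t = 1" "fst c * s + snd c * t = 0"
    using lattice_vertex[OF N' ge1 mn, of 1 0] by blast
  obtain s' t' where 2: "fst b * s' + snd b * t' = 0" "fst c * s' + snd c * t' = 1"
    using lattice_vertex[OF N' ge1 mn, of 0 1] by blast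
  have "det2 b c * (s * t' - t * s') = (fst b * s + snd b * t) * (fst c * s' + snd c * t')
      - (fst b * s' + snd b * t') * (fst c * s + snd c * t)"
    by (simp add: det2_def algebra_simps)
  then have "det2 b c * (s * t' - t * s') = 1" by (simp add: 1 2)
  then have "det2 b c dvd 1" by (metis dvd_triv_left)
  then show False using ge by simp
qed

text \<open>The hypotheses are cyclically symmetric, so the smallest determinant can be rotated into
  the place of \<open>det2 b c\<close>.\<close>

lemma no_bad_triple:
  assumes N: "integrally_feasible S" and S: "a \<in> S" "b \<in> S" "c \<in> S"
    and ge: "det2 a b \<ge> 2" "det2 b c \<ge> 2" "det2 c a \<ge> 2"
  shows False
proof -
  consider "det2 b c \<le> det2 c a" "det2 b c \<le> det2 a b" | "det2 c a \<le> det2 a b" "det2 c a \<le> det2 b c"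
    | "det2 a b \<le> det2 b c" "det2 a b \<le> det2 c a" by linarith
  then show False
    using no_bad_triple_min[OF N S ge(2)] no_bad_triple_min[OF N S(2,3,1) ge(3)]
      no_bad_triple_min[OF N S(3,1,2) ge(1)] by cases blast+
qed

text \<open>The system only sees the form \<open>H = x * s + y * t\<close>, and the bounds 1 and -1
  confine \<open>H\<close> to the interval from \<open>1 / n\<close> to \<open>1 / m\<close>. It is
  nonempty because \<open>m\<close> is at most \<open>n\<close>, but contains no integer.\<close>

lemma no_bad_opposite_min:
  fixes m n :: int
  assumes N: "integrally_feasible S" and S: "(m * x, m * y) \<in> S" "(- n * x, - n * y) \<in> S"
    and mn: "2 \<le> m" "m \<le> n" and nz: "x \<noteq> 0 \<or> y \<noteq> 0"
  shows False
proof -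
  let ?b = "(m * x, m * y)" and ?c = "(- n * x, - n * y)"
  have ne: "?b \<noteq> ?c"
  proof
    assume "?b = ?c"
    then have "(m + n) * x = 0" "(m + n) * y = 0" by (simp_all add: algebra_simps)
    then show False using mn nz by simp
  qed
  have N': "integrally_feasible {?b, ?c}"
    by (rule integrally_feasible_subset[OF N]) (use S in blast)
  define r :: real where "r = x * x + y * y"
  have r: "r > 0" using nz by (simp add: r_def sum_squares_gt_zero_iff)
  define p where "p = (\<lambda>v. if v = ?b then 1 else -1 :: int)"
  have key: "of_int (k * x) * (x / (n * r)) + of_int (k * y) * (y / (n * r)) = k / n" for k :: int
  proof -
    have "of_int (k * x) * (x / (n * r)) + of_int (k * y) * (y / (n * r)) = k * r / (n * r)"
      by (simp add: r_def add_divide_distrib algebra_simps)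
    then show ?thesis using r by simp
  qed
  obtain s t where st: "\<And>b. b \<in> {?b, ?c} \<Longrightarrow> fst b * s + snd b * t \<le> p b"
  proof (rule integrally_feasibleD[OF N', where p = p and s = "x / (n * r)" and t = "y / (n * r)"])
    fix b assume "b \<in> {?b, ?c}"
    then show "of_int (fst b) * (x / (n * r)) + of_int (snd b) * (y / (n * r)) \<le> of_int (p b)"
      using key[of m] key[of "-n"] ne mn by (auto simp: p_def)
  qed blast
  define H where "H = x * s + y * t"
  have "m * H \<le> 1" "- n * H \<le> -1"
    using st[of ?b] st[of ?c] ne by (auto simp: p_def H_def algebra_simps)
  note H = this
  have "H \<le> 0"
  proof (rule ccontr)
    assume "\<not> H \<le> 0"
    then have "m * 1 \<le> m * H" using mn by (intro mult_left_mono) linarith+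
    then show False using H mn by linarith
  qed
  then have "n * H \<le> 0" using mn by (intro mult_nonneg_nonpos) linarith+
  then show False using H by simp
qed

lemma no_bad_opposite:
  fixes m n :: int
  assumes N: "integrally_feasible S" and S: "(m * x, m * y) \<in> S" "(- n * x, - n * y) \<in> S"
    and mn: "2 \<le> m" "2 \<le> n" and nz: "x \<noteq> 0 \<or> y \<noteq> 0"
  shows False
proof (cases "m \<le> n")
  case True
  then show False using no_bad_opposite_min[OF N S mn(1) _ nz] by blast
next
  case False
  have "(n * - x, n * - y) \<in> S" "(- m * - x, - m * - y) \<in> S" using S by simp_all
  then show False using no_bad_opposite_min[OF N, of n "-x" "-y" m] False mn nz by simp
qed

text \<open>With bounds 0, 0 and \<open>M\<close>, where \<open>M\<close> is below both
  \<open>a\<close> and \<open>b\<close>, the origin is the only integral candidate, and the bound -1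
  for \<open>(x, y)\<close> excludes it. A real solution on one of the two axes survives.\<close>

lemma no_bad_quadrangle_coords:
  fixes x y a b :: int
  assumes N: "integrally_feasible S"
    and S: "(1, 0) \<in> S" "(0, 1) \<in> S" "(x, y) \<in> S" "(- a, - b) \<in> S"
    and ge: "x \<ge> 2" "y \<ge> 2" "a \<ge> 2" "b \<ge> 2"
  shows False
proof -
  let ?T = "{(1, 0), (0, 1), (x, y), (- a, - b)}"
  have N': "integrally_feasible ?T"
    by (rule integrally_feasible_subset[OF N]) (use S in blast)
  \<comment> \<open>\<open>U\<close>, \<open>V\<close> are the slacks of the inequalities for \<open>(1, 0)\<close> and \<open>(0, 1)\<close>.\<close>
  have step: False
    if h: "M < a" "M < b" "real_of_int x * U + y * V \<ge> 1" "a * U + b * V \<le> real_of_int M" "U \<ge> 0" "V \<ge> 0"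
    for M :: int and U V :: real
  proof -
    define p where "p = (\<lambda>v. if v = (x, y) then -1 else if v = (- a, - b) then M else 0)"
    obtain s t where st: "\<And>b. b \<in> ?T \<Longrightarrow> fst b * s + snd b * t \<le> p b"
    proof (rule integrally_feasibleD[OF N', where p = p and s = "-U" and t = "-V"])
      fix v assume "v \<in> ?T"
      then show "of_int (fst v) * - U + of_int (snd v) * - V \<le> of_int (p v)"
        using h ge by (auto simp: p_def)
    qed blast
    have 1: "s \<le> 0" "t \<le> 0" "x * s + y * t \<le> -1" "a * (- s) + b * (- t) \<le> M"
      using st[of "(1, 0)"] st[of "(0, 1)"] st[of "(x, y)"] st[of "(- a, - b)"] ge
      by (auto simp: p_def)
    have nn: "a * (- s) \<ge> 0" "b * (- t) \<ge> 0" using 1 ge by (auto intro!: mult_nonneg_nonneg simp del: mult_minus_right)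
    have "s = 0"
    proof (rule ccontr)
      assume "s \<noteq> 0"
      then have "a * 1 \<le> a * (- s)" using 1 ge by (intro mult_left_mono) auto
      then show False using 1 nn h by linarith
    qed
    moreover have "t = 0"
    proof (rule ccontr)
      assume "t \<noteq> 0"
      then have "b * 1 \<le> b * (- t)" using 1 ge by (intro mult_left_mono) auto
      then show False using 1 nn h by linarith
    qed
    ultimately show False using 1 by simp
  qed
  \<comment> \<open>The quotient is at most \<open>e / 2\<close>, hence at most
    \<open>e - 1\<close>, so rounding it up stays below \<open>e\<close>.\<close>
  have lt: "\<lceil>real_of_int c / d\<rceil> < e" if "2 \<le> d" "2 \<le> e" "real_of_int c / d \<le> e / f" "2 \<le> f" for c d e f :: int
  proof -
    have "real_of_int e / f \<le> e / 2" using that by (intro divide_left_mono) auto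
    moreover have "real_of_int e \<ge> 2" using that by simp
    ultimately have "real_of_int c / d \<le> real_of_int e - 1" using that(3) by linarith
    then have "\<lceil>real_of_int c / d\<rceil> \<le> e - 1" by (intro ceiling_le) simp
    then show ?thesis by simp
  qed
  show False
  \<comment> \<open>The axis with the smaller ratio is used, since its rounded value has to stay
    below both \<open>a\<close> and \<open>b\<close>.\<close>
  proof (cases "real_of_int a / x \<le> b / y")
    case True
    show False
    proof (rule step[of "\<lceil>real_of_int a / x\<rceil>" "1 / x" 0])
      show "\<lceil>real_of_int a / x\<rceil> < a" by (rule lt[of x a a x]) (use ge in auto)
      show "\<lceil>real_of_int a / x\<rceil> < b" by (rule lt[of x b a y]) (use ge True in auto)
      show "real_of_int a * (1 / x) + real_of_int b * 0 \<le> real_of_int \<lceil>real_of_int a / x\<rceil>" by simp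
    qed (use ge in auto)
  next
    case False
    show False
    proof (rule step[of "\<lceil>real_of_int b / y\<rceil>" 0 "1 / y"])
      show "\<lceil>real_of_int b / y\<rceil> < a" by (rule lt[of y a b x]) (use ge False in auto)
      show "\<lceil>real_of_int b / y\<rceil> < b" by (rule lt[of y b b y]) (use ge in auto)
      show "real_of_int a * 0 + real_of_int b * (1 / y) \<le> real_of_int \<lceil>real_of_int b / y\<rceil>" by simp
    qed (use ge in auto)
  qed
qed

text \<open>The diagonal \<open>g1\<close>, \<open>g3\<close> is a lattice basis. In its coordinates
  the other two vectors lie in opposite quadrants, with all entries of absolute value at least
  2.\<close>

lemma no_bad_quadrangle:
  assumes N: "integrally_feasible S" and S: "g1 \<in> S" "g2 \<in> S" "g3 \<in> S" "g4 \<in> S"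
    and D: "det2 g1 g3 = 1"
    and ge: "det2 g1 g2 \<ge> 2" "det2 g2 g3 \<ge> 2" "det2 g3 g4 \<ge> 2" "det2 g4 g1 \<ge> 2"
  shows False
proof -
  let ?f = "lin2 (snd g3) (- fst g3) (- snd g1) (fst g1)"
  have f: "?f v = (det2 v g3, det2 g1 v)" for v by (simp add: lin2_def det2_def algebra_simps)
  have "snd g3 * fst g1 - - fst g3 * - snd g1 = 1" using D by (simp add: det2_def algebra_simps)
  then have N': "integrally_feasible (?f ` S)" by (intro integrally_feasible_lin2 N) simp
  have m: "\<And>v. v \<in> S \<Longrightarrow> (det2 v g3, det2 g1 v) \<in> ?f ` S" using f by (metis imageI)
  have sw: "det2 u v = - det2 v u" for u v by (simp add: det2_def)
  have z: "det2 v v = 0" for v by (simp add: det2_def)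
  have "(- det2 g3 g4, - det2 g4 g1) \<in> ?f ` S" using m[OF S(4)] sw by metis
  then show False
    using no_bad_quadrangle_coords[OF N', of "det2 g2 g3" "det2 g1 g2" "det2 g3 g4" "det2 g4 g1"]
      m[OF S(1)] m[OF S(2)] m[OF S(3)] D z ge by simp
qed

section \<open>Construction of frames in the plane\<close>

text \<open>Take \<open>w\<close> as the rightmost vector at height 1. Its first entry is
  nonpositive, so passing to the basis \<open>(1, 0)\<close>, \<open>w\<close> cannot raise the
  first coordinate of a vector at height at most 0, and makes it nonpositive at height 1.\<close>

lemma frame_of_upper_bound:
  assumes fin: "finite S" and v: "(1, 0) \<in> S"
    and le: "\<And>x y. (x, y) \<in> S \<Longrightarrow> x \<le> 1 \<and> y \<le> 1 \<and> (x = 1 \<longrightarrow> y \<le> 0)"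
    and pos: "(x0, y0) \<in> S" "y0 > 0"
  shows "\<exists>v w. frame S v w"
proof -
  let ?X = "fst ` {b \<in> S. snd b = 1}"
  have "(x0, 1) \<in> S" using le[OF pos(1)] pos by (metis int_one_le_iff_zero_less order_antisym)
  then have ne: "?X \<noteq> {}" by force
  define x where "x = Max ?X"
  have "x \<in> ?X" unfolding x_def by (rule Max_in) (use fin ne in auto)
  then have x: "(x, 1) \<in> S" by auto
  then have x0: "x \<le> 0" using le[OF x] by auto
  have mx: "z \<le> x" if "(z, 1) \<in> S" for z
    unfolding x_def by (rule Max_ge) (use fin that in force)+
  have "det2 b (x, 1) \<le> 1 \<and> det2 (1, 0) b \<le> 1 \<and> \<not> (det2 b (x, 1) = 1 \<and> det2 (1, 0) b = 1)" if "b \<in> S" for b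
  proof -
    obtain p q where b: "b = (p, q)" by (cases b)
    have "p \<le> 1" "q \<le> 1" using le[of p q] that b by auto
    show ?thesis
    proof (cases "q = 1")
      case True
      then show ?thesis using mx[of p] that b by (simp add: det2_def)
    next
      case False
      then have q: "q \<le> 0" using \<open>q \<le> 1\<close> by simp
      then have "q * x \<ge> 0" using x0 by (simp add: mult_nonpos_nonpos)
      then show ?thesis using q \<open>p \<le> 1\<close> by (simp add: b det2_def)
    qed
  qed
  then have "frame S (1, 0) (x, 1)" using v x by (simp add: frame_def det2_def)
  then show ?thesis by blast
qed

text \<open>
  The extreme vectors of \<open>S\<close> on the line \<open>x = 1\<close> are \<open>v = (1, 0)\<close> and \<open>u = (1, - k)\<close>. There is a frame
  containing \<open>v\<close> unless some \<open>b\<close> lies on or above \<open>y = 2\<close>, and one containing \<open>u\<close> unless some \<open>c\<close>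
  satisfies the mirror image of this condition. Suppose that both exist. If
  \<open>k = 1\<close>, then \<open>u\<close>, \<open>v\<close> is a frame. Otherwise among \<open>u\<close>, \<open>v\<close>,
  \<open>b\<close>, \<open>c\<close> there is a forbidden triangle or quadrangle, with the single exception \<open>k = 3\<close>,
  \<open>b = (-1, 2)\<close>, \<open>c = (-1, 1)\<close>, where \<open>b\<close> and \<open>c\<close> form a frame.
\<close>

lemma frame_of_strip:
  assumes N: "integrally_feasible S" and fin: "finite S" and v: "(1, 0) \<in> S"
    and x1: "\<And>x y. (x, y) \<in> S \<Longrightarrow> x \<le> 1" and y0: "\<And>y. (1, y) \<in> S \<Longrightarrow> y \<le> 0"
    and span: "\<And>s t. (s, t) \<noteq> (0, 0) \<Longrightarrow> \<exists>b\<in>S. fst b * s + snd b * t > (0::int)"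
  shows "\<exists>v w. frame S v w"
proof -
  let ?Y = "(\<lambda>b. - snd b) ` {b \<in> S. fst b = 1}"
  define k where "k = Max ?Y"
  have "k \<in> ?Y" unfolding k_def by (rule Max_in) (use fin v in force)+
  then have u: "(1, - k) \<in> S" by force
  have k0: "k \<ge> 0" using y0[OF u] by simp
  have kmax: "- y \<le> k" if "(1, y) \<in> S" for y
    unfolding k_def by (rule Max_ge) (use fin that in force)+
  show ?thesis
  proof (cases "(\<exists>x y. (x, y) \<in> S \<and> y \<ge> 2) \<and> (\<exists>x y. (x, y) \<in> S \<and> - y - k * x \<ge> 2)")
    case False
    then consider "\<And>x y. (x, y) \<in> S \<Longrightarrow> y \<le> 1" | "\<And>x y. (x, y) \<in> S \<Longrightarrow> - y - k * x \<le> 1"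
      by (metis add1_zle_eq not_le one_add_one)
    then show ?thesis
    proof cases
      case 1
      obtain x y where "(x, y) \<in> S" "y > 0" using span[of 0 1] by force
      then show ?thesis using frame_of_upper_bound[OF fin v] x1 y0 1 by blast
    next
      case 2
      \<comment> \<open>This involution preserves the line \<open>x = 1\<close> and exchanges
        \<open>u\<close> with \<open>v\<close>, turning the mirrored bound into a bound on
        \<open>y\<close>.\<close>
      let ?f = "lin2 1 0 (- k) (- 1)"
      have f: "?f b = (fst b, - snd b - k * fst b)" for b by (simp add: lin2_def)
      have "\<exists>b\<in>S. fst b * - k + snd b * - 1 > 0" by (rule span) simp
      then obtain b where b: "b \<in> S" "- snd b - k * fst b > 0" by (auto simp: algebra_simps)
      have "\<exists>v w. frame (?f ` S) v w"
      proof (rule frame_of_upper_bound)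
        show "finite (?f ` S)" using fin by simp
        have "?f (1, - k) = (1, 0)" by (simp add: f)
        then show "(1, 0) \<in> ?f ` S" using u by (metis imageI)
        show "(fst b, - snd b - k * fst b) \<in> ?f ` S" using b(1) f by (metis imageI)
        show "- snd b - k * fst b > 0" by (rule b)
        fix x y assume "(x, y) \<in> ?f ` S"
        then obtain p q where pq: "(p, q) \<in> S" "x = p" "y = - q - k * p" by (auto simp: f)
        have "- q \<le> k" if "p = 1" using kmax[of q] pq that by simp
        then show "x \<le> 1 \<and> y \<le> 1 \<and> (x = 1 \<longrightarrow> y \<le> 0)" using 2[OF pq(1)] x1[OF pq(1)] pq by auto
      qed
      then show ?thesis by (rule frame_lin2) simp
    qed
  next
    case True
    then obtain bx by' cx cy where b: "(bx, by') \<in> S" "by' \<ge> 2" and c: "(cx, cy) \<in> S" "- cy - k * cx \<ge> 2"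
      by blast
    have bx: "bx \<le> 0" using x1[OF b(1)] y0[of by'] b by (cases "bx = 1") auto
    have cx: "cx \<le> 0" using x1[OF c(1)] kmax[of cy] c by (cases "cx = 1") auto
    have opp: False if "(0, m) \<in> S" "(0, - n) \<in> S" "m \<ge> 2" "n \<ge> 2" for m n
      using no_bad_opposite[OF N, of m 0 1 n] that by simp
    have T: "p' * q'' - q' * p'' < 2" if "(p, q) \<in> S" "(p', q') \<in> S" "(p'', q'') \<in> S"
      "p * q' - q * p' \<ge> 2" "p'' * q - q'' * p \<ge> 2" for p q p' q' p'' q''
      using no_bad_triple[OF N that(1-3)] that(4,5) by (force simp: det2_def)
    \<comment> \<open>Together with \<open>v\<close> such a pair forms a forbidden triangle, unless
      both vectors lie on the second axis, where they are a forbidden opposite pair.\<close>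
    have two: False if "(p, q) \<in> S" "(p', q') \<in> S" "p \<le> 0" "p' \<le> 0" "q \<ge> 2" "q' \<le> - 2" for p q p' q'
    proof -
      have "p * q' - q * p' < 2" using T[OF v that(1,2)] that by simp
      moreover have "(- p) * 2 \<le> (- p) * (- q')" "(- p') * 2 \<le> (- p') * q"
        by (rule mult_left_mono; use that in linarith)+
      ultimately have "p = 0" "p' = 0" using that by (auto simp: algebra_simps)
      then show False using opp[of q "- q'"] that by simp
    qed
    consider "k = 0" | "k = 1" | "k \<ge> 2" using k0 by linarith
    then show ?thesis
    proof cases
      case 1
      then show ?thesis using two[OF b(1) c(1) bx cx] b c by simp
    next
      case 2
      \<comment> \<open>The coordinates of \<open>(x, y)\<close> in this basis are
        \<open>- y\<close> and \<open>x + y\<close>. Their sum is \<open>x\<close>, so they cannot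
        both be 1.\<close>
      have "det2 d (1, 0) \<le> 1 \<and> det2 (1, -1) d \<le> 1 \<and> \<not> (det2 d (1, 0) = 1 \<and> det2 (1, -1) d = 1)"
        if "d \<in> S" for d
      proof -
        obtain x y where d: "d = (x, y)" by (cases d)
        show ?thesis
        proof (cases "x = 1")
          case True
          then show ?thesis using y0[of y] kmax[of y] that d 2 by (auto simp: det2_def)
        next
          case False
          then have x: "x \<le> 0" using x1[of x y] that d by simp
          have "y > - 2" using two[OF b(1) _ bx x b(2), of y] that d by force
          \<comment> \<open>The mirror image of \<open>two\<close>, with \<open>u\<close> in the
            role of \<open>v\<close>.\<close>
          moreover have "x + y < 2"
          proof (rule ccontr)
            assume ge: "\<not> x + y < 2"
            have "x * cy - y * cx < 2"
              by (rule T[of 1 "-1"]) (use u 2 that d c ge in auto)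
            moreover have "(- x) * (2 + cx) \<le> (- x) * (- cy)" "(- cx) * (2 - x) \<le> (- cx) * y"
              by (rule mult_left_mono; use x cx c 2 ge in simp)+
            ultimately have "x = 0" "cx = 0" using x cx by (auto simp: algebra_simps)
            then show False using opp[of y "- cy"] c 2 ge that d by simp
          qed
          ultimately show ?thesis using x by (auto simp: d det2_def)
        qed
      qed
      then have "frame S (1, -1) (1, 0)" using u v 2 by (simp add: frame_def det2_def)
      then show ?thesis by blast
    next
      case 3
      have special: "k = 3 \<and> bx = -1 \<and> b2 = 2 \<and> cx = -1 \<and> cy = 1"
        if b: "(bx, b2) \<in> S" "b2 \<ge> 2" "bx \<le> 0" and c: "(cx, cy) \<in> S" "- cy - k * cx \<ge> 2" "cx \<le> 0"
        for bx b2 cx cy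
      proof -
        \<comment> \<open>The triangles \<open>u\<close>, \<open>v\<close>, \<open>b\<close> and
          \<open>u\<close>, \<open>v\<close>, \<open>c\<close> already have two determinants that
          are at least 2, which bounds the third.\<close>
        have b': "- k * bx - b2 \<le> 1" 
        proof (rule ccontr)
          assume "\<not> - k * bx - b2 \<le> 1"
          then show False
            by (intro no_bad_triple[OF N u v b(1)]) (use b 3 in \<open>auto simp: det2_def algebra_simps\<close>)
        qed
        have c2: "cy \<le> 1" 
        proof (rule ccontr)
          assume "\<not> cy \<le> 1"
          then show False
            by (intro no_bad_triple[OF N u v c(1)]) (use c 3 in \<open>auto simp: det2_def algebra_simps\<close>)
        qed
        have c3: "cy \<ge> -1" using two[OF b(1) c(1) b(3) c(3) b(2)] by force
        have cx: "cx \<le> -1" using c c3 by (cases "cx = 0") auto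
        \<comment> \<open>\<open>D\<close> is the determinant of \<open>b\<close> and
          \<open>c\<close>. If it is below 2, the inequalities collected so far leave only the
          exceptional configuration.\<close>
        define D where "D = bx * cy - b2 * cx"
        show ?thesis
        proof (cases "D \<ge> 2")
          case False
          have b2cx: "b2 * 1 \<le> b2 * (- cx)" using b cx by (intro mult_left_mono) auto
          have "cy = 1"
          proof (rule ccontr)
            assume "cy \<noteq> 1"
            then have "cy \<le> 0" using c2 by simp
            then have "bx * cy \<ge> 0" using b by (simp add: mult_nonpos_nonpos)
            then show False using False b2cx b by (simp add: D_def)
          qed
          have kb: "2 * (- bx) \<le> k * (- bx)" using 3 b by (intro mult_right_mono) auto
          have "cx = -1"
          proof (rule ccontr)
            assume "cx \<noteq> -1"
            then have "b2 * 2 \<le> b2 * (- cx)" using b cx by (intro mult_left_mono) auto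
            then show False using False b' kb b \<open>cy = 1\<close> by (simp add: D_def)
          qed
          then have k3: "k \<ge> 3" using c \<open>cy = 1\<close> by simp
          then have kb: "3 * (- bx) \<le> k * (- bx)" using b by (intro mult_right_mono) auto
          have "3 * (- bx) \<le> b2 + 1" using kb b' by linarith
          moreover have "bx + b2 < 2" using False \<open>cy = 1\<close> \<open>cx = -1\<close> by (simp add: D_def)
          ultimately have "b2 = 2" "bx = -1" using b(2) by linarith+
          then show ?thesis using k3 b' \<open>cy = 1\<close> \<open>cx = -1\<close> by simp
        next
          case True
          have d1: "b2 + k * bx \<le> 1"
          proof (rule ccontr)
            assume "\<not> b2 + k * bx \<le> 1"
            then show False
              by (intro no_bad_triple[OF N u b(1) c(1)]) (use True c in \<open>auto simp: det2_def D_def algebra_simps\<close>)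
          qed
          note det2 = det2_def D_def algebra_simps
          \<comment> \<open>In the cyclic order \<open>u\<close>, \<open>v\<close>,
            \<open>b\<close>, \<open>c\<close> all consecutive determinants are at least 2, and the
            diagonals have determinants \<open>b2 + k * bx\<close> and \<open>cy\<close> between -1
            and 1. A diagonal of determinant 1 or -1 gives a forbidden quadrangle, so only two zero
            diagonals remain.\<close>
          have False
          proof -
            consider "cy = -1" | "cy = 1" | "cy = 0" "b2 + k * bx = 1" | "cy = 0" "b2 + k * bx = -1"
              | "cy = 0" "b2 + k * bx = 0"
              using c2 c3 b' d1 by force
            then show False
            proof cases
              case 1
              then show False
                by (intro no_bad_quadrangle[OF N c(1) u v b(1)]) (use 1 True b c \<open>2 \<le> k\<close> in \<open>auto simp: det2\<close>)
            next
              case 2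
              then show False
                by (intro no_bad_quadrangle[OF N v b(1) c(1) u]) (use 2 True b c \<open>2 \<le> k\<close> in \<open>auto simp: det2\<close>)
            next
              case 3
              then show False
                by (intro no_bad_quadrangle[OF N u v b(1) c(1)]) (use 3 True b c \<open>2 \<le> k\<close> in \<open>auto simp: det2\<close>)
            next
              case 4
              then show False
                by (intro no_bad_quadrangle[OF N b(1) c(1) u v]) (use 4 True b c \<open>2 \<le> k\<close> in \<open>auto simp: det2\<close>)
            next
              case 5
              have bx: "bx < 0" using 5 b by (cases "bx = 0") auto
              let ?T = "{(1, - k), (1, 0), (bx, b2), (cx, cy)}"
              have N': "integrally_feasible ?T"
                by (rule integrally_feasible_subset[OF N]) (use u v b c in blast)
              have b2: "b2 = - (k * bx)" using 5 by simp
              \<comment> \<open>Now \<open>b\<close> is a negative multiple of \<open>u\<close> and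
                \<open>c\<close> one of \<open>v\<close>. These bounds turn the inequalities into
                equations whose only solution is \<open>s = 1\<close>,
                \<open>t = 1 / k\<close>.\<close>
              define p where "p = (\<lambda>v. if v = (1, 0) then 1 else if v = (cx, cy) then cx else 0)"
              obtain s t where st: "\<And>v. v \<in> ?T \<Longrightarrow> fst v * s + snd v * t \<le> p v"
              proof (rule integrally_feasibleD[OF N', where p = p and s = 1 and t = "1 / k"])
                fix v assume "v \<in> ?T"
                then show "of_int (fst v) * 1 + of_int (snd v) * (1 / real_of_int k) \<le> of_int (p v)"
                  using 5 cx bx \<open>2 \<le> k\<close> by (auto simp: p_def b2)
              qed blast
              have 1: "s \<le> 1" "cx * s \<le> cx" "s - k * t \<le> 0" "bx * s - k * bx * t \<le> 0"
                using st[of "(1, 0)"] st[of "(cx, cy)"] st[of "(1, - k)"] st[of "(bx, b2)"] cx bx 5 \<open>2 \<le> k\<close>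
                by (auto simp: p_def b2)
              have "s = 1" using 1 cx by (smt (verit) mult_less_cancel_left1)
              moreover have "bx * (s - k * t) \<le> 0" using 1 by (simp add: algebra_simps)
              then have "s - k * t \<ge> 0" using bx by (simp add: mult_le_0_iff)
              ultimately have "k * t = 1" using 1 by simp
              then show False using \<open>2 \<le> k\<close> by (simp add: zmult_eq_1_iff)
            qed
          qed
          then show ?thesis ..
        qed
      qed
      have k3: "k = 3" and b': "(-1, 2) \<in> S" and c': "(-1, 1) \<in> S"
        using special[OF b bx c cx] b c by auto
      have "det2 d (-1, 1) \<le> 1 \<and> det2 (-1, 2) d \<le> 1 \<and> \<not> (det2 d (-1, 1) = 1 \<and> det2 (-1, 2) d = 1)"
        if "d \<in> S" for d
      proof -
        obtain x y where d: "d = (x, y)" by (cases d)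
        show ?thesis
        proof (cases "x = 1")
          case True
          then show ?thesis using y0[of y] kmax[of y] that d k3 by (auto simp: det2_def)
        next
          case False
          then have x: "x \<le> 0" using x1[of x y] that d by simp
          \<comment> \<open>\<open>special\<close> also applies with \<open>d\<close> in the place
            of \<open>b\<close> or of \<open>c\<close>, so a vector beyond either line is
            \<open>(-1, 2)\<close> or \<open>(-1, 1)\<close>.\<close>
          have 1: "x = -1 \<and> y = 2" if "y \<ge> 2" using special[OF _ that x c cx] \<open>d \<in> S\<close> d by simp
          have 2: "x = -1 \<and> y = 1" if "- y - 3 * x \<ge> 2"
            using special[OF b bx _ _ x, of y] \<open>d \<in> S\<close> d that k3 by simp
          show ?thesis using x 1 2 by (force simp: d det2_def)
        qed
      qed
      then have "frame S (-1, 2) (-1, 1)" using b' c' by (simp add: frame_def det2_def)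
      then show ?thesis by blast
    qed
  qed
qed

lemma det2_plucker:
  "(fst x * s + snd x * t) * det2 y z + (fst y * s + snd y * t) * det2 z x + (fst z * s + snd z * t) * det2 x y = 0"
  by (simp add: det2_def algebra_simps)

text \<open>The real solution uses only first coordinates: dividing by the extreme of smaller
  absolute value pushes the opposite extreme to -1 or below and keeps all values at most 1. The
  bound -1 imposed there keeps the integral solution away from zero.\<close>

lemma nonzero_lattice_point_in_polar:
  assumes N: "integrally_feasible S" and fin: "finite S"
    and span: "\<And>s t. (s, t) \<noteq> (0, 0) \<Longrightarrow> \<exists>b\<in>S. fst b * s + snd b * t > (0::int)"
  shows "\<exists>s t. (s, t) \<noteq> (0, 0) \<and> (\<forall>b\<in>S. fst b * s + snd b * t \<le> (1::int))"
proof -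
  have "\<exists>b\<in>S. fst b * 1 + snd b * 0 > 0" by (rule span) simp
  then obtain b where b: "b \<in> S" "fst b > 0" by auto
  have "\<exists>b\<in>S. fst b * (-1) + snd b * 0 > 0" by (rule span) simp
  then obtain c where c: "c \<in> S" "fst c < 0" by auto
  define M where "M = Max (fst ` S)"
  define m where "m = Min (fst ` S)"
  have M: "M \<in> fst ` S" and m: "m \<in> fst ` S"
    unfolding M_def m_def using fin b by (auto intro!: Max_in Min_in)
  have le: "m \<le> fst d \<and> fst d \<le> M" if "d \<in> S" for d
    unfolding M_def m_def using fin that by simp
  have M0: "M > 0" and m0: "m < 0" using le[OF b(1)] le[OF c(1)] b c by auto
  have "\<exists>a\<in>S. \<exists>h::real. fst a * h \<le> -1 \<and> (\<forall>d\<in>S. fst d * h \<le> 1)"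
  proof (cases "- m \<ge> M")
    case True
    obtain a where a: "a \<in> S" "fst a = m" using m by auto
    have "real_of_int m \<le> - M" using True by linarith
    then have "real_of_int (fst a) * (1 / M) \<le> -1" using M0 a by (simp add: field_simps)
    moreover have "real_of_int (fst d) * (1 / M) \<le> 1" if "d \<in> S" for d
      using M0 le[OF that] by simp
    ultimately show ?thesis using a by blast
  next
    case False
    obtain a where a: "a \<in> S" "fst a = M" using M by auto
    have "real_of_int M \<ge> - m" using False by linarith
    then have "real_of_int (fst a) * (1 / m) \<le> -1" using m0 a by (simp add: field_simps)
    moreover have "real_of_int (fst d) * (1 / m) \<le> 1" if "d \<in> S" for d
      using m0 le[OF that] by (simp add: field_simps)
    ultimately show ?thesis using a by blast
  qed
  then obtain a and h :: real where a: "a \<in> S" "real_of_int (fst a) * h \<le> -1"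
      "\<And>d. d \<in> S \<Longrightarrow> real_of_int (fst d) * h \<le> 1"
    by blast
  define p where "p = (\<lambda>v. if v = a then -1 else 1 :: int)"
  obtain s t where st: "\<And>b. b \<in> S \<Longrightarrow> fst b * s + snd b * t \<le> p b"
  proof (rule integrally_feasibleD[OF N, where p = p and s = h and t = 0])
    fix b assume "b \<in> S"
    then show "of_int (fst b) * h + of_int (snd b) * 0 \<le> of_int (p b)"
      using a by (simp add: p_def)
  qed blast
  have "fst b * s + snd b * t \<le> 1" if "b \<in> S" for b
    using st[OF that] by (simp add: p_def split: if_splits)
  moreover have "(s, t) \<noteq> (0, 0)" using st[OF a(1)] by (auto simp: p_def)
  ultimately show ?thesis by blast
qed

text \<open>A lattice point of the polar is a form that is at most 1 on \<open>S\<close> and attains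
  1. With this form as first coordinate and \<open>det2 v\<close>, for an extreme \<open>v\<close>
  on its level 1, as second, \<open>S\<close> lies in a strip.\<close>

lemma frame_of_spanning:
  assumes N: "integrally_feasible S" and fin: "finite S"
    and span: "\<And>s t. (s, t) \<noteq> (0, 0) \<Longrightarrow> \<exists>b\<in>S. fst b * s + snd b * t > (0::int)"
  shows "\<exists>v w. frame S v w"
proof -
  obtain s t where st: "(s, t) \<noteq> (0, 0)" and le: "\<And>b. b \<in> S \<Longrightarrow> fst b * s + snd b * t \<le> 1"
    using nonzero_lattice_point_in_polar[OF assms] by blast
  obtain v0 where v0: "v0 \<in> S" "fst v0 * s + snd v0 * t > 0" using span[OF st] by blast
  then have v01: "fst v0 * s + snd v0 * t = 1" using le[OF v0(1)] by linarith
  let ?E = "{b \<in> S. fst b * s + snd b * t = 1}"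
  have fE: "finite (det2 v0 ` ?E)" using fin by simp
  have "Max (det2 v0 ` ?E) \<in> det2 v0 ` ?E" by (rule Max_in[OF fE]) (use v0 v01 in blast)
  then obtain v where v: "v \<in> S" "fst v * s + snd v * t = 1" "det2 v0 v = Max (det2 v0 ` ?E)" by auto
  have mx: "det2 v0 b \<le> det2 v0 v" if "b \<in> S" "fst b * s + snd b * t = 1" for b
    unfolding v(3) by (rule Max_ge[OF fE]) (use that in blast)
  let ?f = "lin2 s t (- snd v) (fst v)"
  have f: "?f b = (fst b * s + snd b * t, det2 v b)" for b by (simp add: lin2_def det2_def algebra_simps)
  have det: "s * fst v - t * - snd v = 1" using v(2) by (simp add: algebra_simps)
  have "\<exists>v w. frame (?f ` S) v w"
  proof (rule frame_of_strip)
    show "integrally_feasible (?f ` S)" by (rule integrally_feasible_lin2[OF N]) (use det in simp)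
    show "finite (?f ` S)" using fin by simp
    have "?f v = (1, 0)" using f[of v] v(2) by (simp add: det2_def)
    then show "(1, 0) \<in> ?f ` S" using v(1) by (metis imageI)
    show "x \<le> 1" if "(x, y) \<in> ?f ` S" for x y using that le by (auto simp: f)
    show "y \<le> 0" if y: "(1, y) \<in> ?f ` S" for y
    proof -
      obtain c where c: "c \<in> S" "(1, y) = ?f c" using y by blast
      then have b: "c \<in> S" "fst c * s + snd c * t = 1" "det2 v c = y" unfolding f by simp_all
      \<comment> \<open>On level 1 the determinants taken from \<open>v0\<close> and from
        \<open>v\<close> differ by a constant, so the maximality of \<open>v\<close> bounds
        \<open>det2 v c\<close> by 0.\<close>
      have "det2 v c + det2 c v0 + det2 v0 v = 0" using det2_plucker[of v0 s t v c] v01 v(2) b(2) by simp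
      moreover have "det2 c v0 = - det2 v0 c" by (simp add: det2_def)
      ultimately show ?thesis using mx[OF b(1,2)] b(3) by simp
    qed
    show "\<exists>b\<in>?f ` S. fst b * p + snd b * q > 0" if "(p, q) \<noteq> (0, 0)" for p q
    proof -
      have e: "fst (?f b) * p + snd (?f b) * q = fst b * (s * p - snd v * q) + snd b * (t * p + fst v * q)" for b
        by (simp add: algebra_simps)
      have "(s * p - snd v * q, t * p + fst v * q) \<noteq> (0, 0)"
      proof
        assume "(s * p - snd v * q, t * p + fst v * q) = (0, 0)"
        then have z: "s * p - snd v * q = 0" "t * p + fst v * q = 0" by auto
        have "(fst v * s + snd v * t) * p = fst v * (s * p - snd v * q) + snd v * (t * p + fst v * q)"
          by (simp add: algebra_simps)
        then have "p = 0" unfolding z v(2) by simp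
        have "(fst v * s + snd v * t) * q = s * (t * p + fst v * q) - t * (s * p - snd v * q)"
          by (simp add: algebra_simps)
        then have "q = 0" unfolding z v(2) by simp
        then show False using that \<open>p = 0\<close> by simp
      qed
      then obtain b where b: "b \<in> S" "fst b * (s * p - snd v * q) + snd b * (t * p + fst v * q) > 0"
        using span by blast
      show ?thesis by (rule bexI[of _ "?f b"]) (use b e in simp_all)
    qed
  qed
  then show ?thesis by (rule frame_lin2) (use det in simp)
qed

subsection \<open>The lattice of relations\<close>

text \<open>Fraction-free Gaussian elimination: an equation with a nonzero coefficient is used up
  together with one unknown, so the surplus of unknowns persists.\<close>

lemma integer_system_solution:
  fixes a :: "'i \<Rightarrow> 'j \<Rightarrow> int"
  assumes "finite E" "finite V" "card E < card V"
  shows "\<exists>u. (\<exists>j\<in>V. u j \<noteq> 0) \<and> (\<forall>j. j \<notin> V \<longrightarrow> u j = 0) \<and> (\<forall>i\<in>E. (\<Sum>j\<in>V. a i j * u j) = 0)"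
  using assms
proof (induction E arbitrary: a V rule: finite_induct)
  case empty
  then obtain k where "k \<in> V" by fastforce
  then show ?case by (intro exI[of _ "\<lambda>j. if j = k then 1 else 0"]) auto
next
  case (insert e E)
  show ?case
  proof (cases "\<forall>j\<in>V. a e j = 0")
    case True
    obtain u where "\<exists>j\<in>V. u j \<noteq> 0" "\<forall>j. j \<notin> V \<longrightarrow> u j = 0" "\<forall>i\<in>E. (\<Sum>j\<in>V. a i j * u j) = 0"
      using insert.IH[of V a] insert.prems insert.hyps by auto
    then show ?thesis using True by (intro exI[of _ u]) auto
  next
    case False
    then obtain v where v: "v \<in> V" "a e v \<noteq> 0" by blast
    define b where "b i j = a e v * a i j - a i v * a e j" for i j
    have "card E < card (V - {v})" using insert.prems insert.hyps v by simp
    then obtain w where w: "\<exists>j\<in>V - {v}. w j \<noteq> 0" "\<forall>j. j \<notin> V - {v} \<longrightarrow> w j = 0"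
      "\<forall>i\<in>E. (\<Sum>j\<in>V - {v}. b i j * w j) = 0"
      using insert.IH[of "V - {v}" b] insert.prems by auto
    define W where "W i = (\<Sum>j\<in>V - {v}. a i j * w j)" for i
    \<comment> \<open>Scaling \<open>w\<close> by the pivot \<open>a e v\<close> makes the entry at
      \<open>v\<close> that solves equation \<open>e\<close> an integer.\<close>
    define u where "u j = (if j = v then - W e else a e v * w j)" for j
    have sum: "(\<Sum>j\<in>V. a i j * u j) = a e v * W i - a i v * W e" for i
    proof -
      have "(\<Sum>j\<in>V. a i j * u j) = a i v * u v + (\<Sum>j\<in>V - {v}. a i j * u j)"
        using v insert.prems by (intro sum.remove) auto
      also have "(\<Sum>j\<in>V - {v}. a i j * u j) = (\<Sum>j\<in>V - {v}. a e v * (a i j * w j))"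
        by (intro sum.cong) (auto simp: u_def)
      also have "\<dots> = a e v * W i" by (simp add: W_def sum_distrib_left)
      finally show ?thesis by (simp add: u_def)
    qed
    have "(\<Sum>j\<in>V - {v}. b i j * w j) = a e v * W i - a i v * W e" for i
      unfolding b_def W_def sum_distrib_left sum_subtractf[symmetric]
      by (intro sum.cong) (auto simp: algebra_simps)
    then have "\<forall>i\<in>insert e E. (\<Sum>j\<in>V. a i j * u j) = 0" using w(3) unfolding sum by auto
    moreover have "\<exists>j\<in>V. u j \<noteq> 0" using w(1) v by (auto simp: u_def)
    moreover have "\<forall>j. j \<notin> V \<longrightarrow> u j = 0" using w(2) v by (auto simp: u_def)
    ultimately show ?thesis by blast
  qed
qed

definition relations :: "int^'n^'d \<Rightarrow> ('n::finite \<Rightarrow> int) set" where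
  "relations A = {u. \<forall>i. (\<Sum>j\<in>UNIV. A $ i $ j * u j) = 0}"

lemma relations_comb:
  assumes "u \<in> relations A" "v \<in> relations A"
  shows "(\<lambda>j. s * u j + t * v j) \<in> relations A"
proof -
  have "(\<Sum>j\<in>UNIV. A $ i $ j * (s * u j + t * v j))
      = s * (\<Sum>j\<in>UNIV. A $ i $ j * u j) + t * (\<Sum>j\<in>UNIV. A $ i $ j * v j)" for i
    by (simp add: sum_distrib_left sum.distrib algebra_simps)
  then show ?thesis using assms by (simp add: relations_def)
qed

text \<open>The values at \<open>i\<close> form a subgroup of the integers. Its least positive
  element divides all others, since a remainder would be smaller.\<close>

lemma minimal_entry:
  fixes L :: "('n \<Rightarrow> int) set"
  assumes comb: "\<And>u v s t. u \<in> L \<Longrightarrow> v \<in> L \<Longrightarrow> (\<lambda>j. s * u j + t * v j) \<in> L"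
    and ex: "u \<in> L" "u i \<noteq> 0"
  shows "\<exists>g\<in>L. g i \<noteq> 0 \<and> (\<forall>v\<in>L. g i dvd v i)"
proof -
  define P where "P n \<longleftrightarrow> n > 0 \<and> (\<exists>g\<in>L. g i = int n)" for n :: nat
  have "(\<lambda>j. sgn (u i) * u j + 0 * u j) \<in> L" by (rule comb) (use ex in auto)
  moreover have "sgn (u i) * u i + 0 * u i = int (nat \<bar>u i\<bar>)" by (cases "u i" "0 :: int" rule: linorder_cases) auto
  ultimately have "P (nat \<bar>u i\<bar>)" using ex(2) unfolding P_def by (intro conjI bexI) auto
  then have "P (LEAST n. P n)" by (rule LeastI)
  then obtain g where g: "g \<in> L" "g i > 0" "g i = int (LEAST n. P n)" by (auto simp: P_def)
  have "g i dvd v i" if "v \<in> L" for v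
  proof (rule ccontr)
    assume nd: "\<not> g i dvd v i"
    have "(\<lambda>j. 1 * v j + (- (v i div g i)) * g j) \<in> L" by (rule comb[OF that g(1)])
    moreover have "1 * v i + (- (v i div g i)) * g i = v i mod g i"
      by (simp add: minus_div_mult_eq_mod)
    moreover have "v i mod g i \<ge> 0" "v i mod g i < g i" "v i mod g i \<noteq> 0"
      using g nd by (auto simp: dvd_eq_mod_eq_0)
    ultimately have "P (nat (v i mod g i))" unfolding P_def by (intro conjI bexI) auto
    then have "(LEAST n. P n) \<le> nat (v i mod g i)" by (rule Least_le)
    then show False using \<open>v i mod g i < g i\<close> \<open>v i mod g i \<ge> 0\<close> g(3) by linarith
  qed
  then show ?thesis using g by (intro bexI[of _ g]) auto
qed

text \<open>By the rank condition the orthogonal complement of the row space is a plane, and the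
  triangular pattern of entries at \<open>i\<close>, \<open>j\<close> makes \<open>u\<close>,
  \<open>v\<close> a basis of it. The coefficients of \<open>w\<close> are read off at
  \<open>i\<close> and \<open>j\<close>.\<close>

lemma relations_determined_by_two:
  fixes A :: "int^'n::finite^'d::finite"
  assumes rk: "rank (map_matrix real_of_int A) = CARD('d)" and card: "CARD('n) = CARD('d) + 2"
    and u: "u \<in> relations A" "u i \<noteq> 0" and v: "v \<in> relations A" "v i = 0" "v j \<noteq> 0"
    and w: "w \<in> relations A" "w i = 0" "w j = 0"
  shows "w = (\<lambda>_. 0)"
proof -
  let ?M = "map_matrix real_of_int A"
  let ?r = "\<lambda>u. (\<chi> j. real_of_int (u j)) :: real^'n"
  let ?K = "{x. \<forall>y\<in>span (rows ?M). orthogonal y x}"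
  have nth: "?M $ a $ b = real_of_int (A $ a $ b)" for a b by (simp add: map_matrix_def)
  have K: "?r x \<in> ?K" if "x \<in> relations A" for x
  proof -
    have z: "(\<Sum>j\<in>UNIV. A $ i $ j * x j) = 0" for i using that by (simp add: relations_def)
    have "(?M *v ?r x) $ i = real_of_int (\<Sum>j\<in>UNIV. A $ i $ j * x j)" for i
      by (simp add: matrix_vector_mult_def nth)
    then have "?M *v ?r x = 0" unfolding z by (simp add: vec_eq_iff)
    then have "orthogonal (?r x) y" if "y \<in> span (rows ?M)" for y
      using orthogonal_nullspace_rowspace that by blast
    then show ?thesis by (auto intro: orthogonal_commute[THEN iffD1])
  qed
  have "dim {y \<in> UNIV. \<forall>x\<in>span (rows ?M). orthogonal x y} + dim (span (rows ?M)) = dim (UNIV :: (real^'n) set)"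
    by (rule dim_subspace_orthogonal_to_vectors) auto
  then have dimK: "dim ?K = 2" using rk card by (simp add: row_rank_def)
  have uv: "?r u \<noteq> ?r v"
  proof
    assume "?r u = ?r v"
    then have "?r u $ i = ?r v $ i" by simp
    then show False using u v by simp
  qed
  have "?r v \<notin> span {}"
  proof
    assume "?r v \<in> span {}"
    then have "?r v $ j = 0" by simp
    then show False using v by simp
  qed
  moreover have "?r u \<notin> span {?r v}"
  proof
    assume "?r u \<in> span {?r v}"
    then obtain k where "?r u = k *\<^sub>R ?r v" by (auto simp: span_breakdown_eq)
    then have "?r u $ i = (k *\<^sub>R ?r v) $ i" by simp
    then have "real_of_int (u i) = k * real_of_int (v i)" by simp
    then show False using u v by simp
  qed
  ultimately have "independent {?r u, ?r v}" by (simp add: independent_insert)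
  then have "?K \<subseteq> span {?r u, ?r v}"
    by (intro card_ge_dim_independent) (use K u v dimK uv in auto)
  then have "?r w \<in> span {?r u, ?r v}" using K[OF w(1)] by blast
  then obtain k l where kl: "?r w - k *\<^sub>R ?r u = l *\<^sub>R ?r v" by (auto simp: span_breakdown_eq)
  have kl': "real_of_int (w b) - k * real_of_int (u b) = l * real_of_int (v b)" for b
    using arg_cong[OF kl, of "\<lambda>x. x $ b"] by simp
  have "k = 0" using kl'[of i] u v w by simp
  moreover have "l = 0" using kl'[of j] v w \<open>k = 0\<close> by simp
  ultimately show ?thesis using kl' by (intro ext) simp
qed

text \<open>The basis is in echelon form: \<open>g\<close> generates the entries at
  \<open>i\<close>, and \<open>f\<close> the entries at \<open>j\<close> of the relations vanishing
  at \<open>i\<close>. Two subtractions leave a relation vanishing at both, hence zero.\<close>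

lemma relations_basis:
  fixes A :: "int^'n::finite^'d::finite"
  assumes rk: "rank (map_matrix real_of_int A) = CARD('d)" and card: "CARD('n) = CARD('d) + 2"
  shows "\<exists>f g. f \<in> relations A \<and> g \<in> relations A \<and>
    (\<forall>u\<in>relations A. \<exists>s t. u = (\<lambda>j. s * f j + t * g j)) \<and>
    (\<forall>s t. (\<lambda>j. s * f j + t * g j) = (\<lambda>_. 0) \<longrightarrow> s = 0 \<and> t = 0)"
proof -
  let ?L = "relations A"
  obtain u where u: "\<exists>j\<in>UNIV. u j \<noteq> 0" "u \<in> ?L"
    using integer_system_solution[of "UNIV :: 'd set" "UNIV :: 'n set" "\<lambda>i j. A $ i $ j"] card
    by (auto simp: relations_def)
  then obtain i where i: "u i \<noteq> 0" by blast
  \<comment> \<open>Even without the unknown at \<open>i\<close> there is one more unknown than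
    equations.\<close>
  obtain v where v: "\<exists>j\<in>UNIV - {i}. v j \<noteq> 0" "\<forall>j. j \<notin> UNIV - {i} \<longrightarrow> v j = 0"
      "\<forall>k. (\<Sum>j\<in>UNIV - {i}. A $ k $ j * v j) = 0"
    using integer_system_solution[of "UNIV :: 'd set" "UNIV - {i}" "\<lambda>i j. A $ i $ j"] card by auto
  obtain j where j: "v j \<noteq> 0" and vi: "v i = 0" using v by auto
  have "(\<Sum>j\<in>UNIV. A $ k $ j * v j) = (\<Sum>j\<in>UNIV - {i}. A $ k $ j * v j)" for k
    using vi by (simp add: sum.remove[of UNIV i])
  then have vL: "v \<in> ?L" using v(3) by (simp add: relations_def)
  obtain g where g: "g \<in> ?L" "g i \<noteq> 0" "\<And>w. w \<in> ?L \<Longrightarrow> g i dvd w i"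
    using minimal_entry[of ?L u i] relations_comb u i by blast
  obtain f where f: "f \<in> ?L" "f i = 0" "f j \<noteq> 0" "\<And>w. w \<in> ?L \<Longrightarrow> w i = 0 \<Longrightarrow> f j dvd w j"
  proof -
    have "\<exists>f\<in>{w \<in> ?L. w i = 0}. f j \<noteq> 0 \<and> (\<forall>w\<in>{w \<in> ?L. w i = 0}. f j dvd w j)"
      by (rule minimal_entry[of _ v]) (use relations_comb vL vi j in auto)
    then show ?thesis using that by blast
  qed
  have "\<exists>s t. w = (\<lambda>j. s * f j + t * g j)" if w: "w \<in> ?L" for w
  proof -
    obtain t where t: "w i = g i * t" using g(3)[OF w] by blast
    define w' where "w' = (\<lambda>j. 1 * w j + (- t) * g j)"
    have w': "w' \<in> ?L" unfolding w'_def by (rule relations_comb[OF w g(1)])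
    have w'i: "w' i = 0" by (simp add: w'_def t)
    obtain s where s: "w' j = f j * s" using f(4)[OF w' w'i] by blast
    define w'' where "w'' = (\<lambda>j. 1 * w' j + (- s) * f j)"
    have "w'' \<in> ?L" unfolding w''_def by (rule relations_comb[OF w' f(1)])
    moreover have "w'' i = 0" "w'' j = 0" by (simp_all add: w''_def w'i f(2) s)
    ultimately have "w'' = (\<lambda>_. 0)"
      using relations_determined_by_two[OF rk card g(1,2) f(1-3)] by blast
    then have "w'' k = 0" for k by simp
    then have "w k = s * f k + t * g k" for k by (simp add: w''_def w'_def algebra_simps)
    then have "w = (\<lambda>j. s * f j + t * g j)" by (rule ext)
    then show ?thesis by blast
  qed
  moreover have "s = 0 \<and> t = 0" if "(\<lambda>j. s * f j + t * g j) = (\<lambda>_. 0)" for s t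
    using fun_cong[OF that, of i] fun_cong[OF that, of j] f(2,3) g(2) by simp
  ultimately show ?thesis using f(1) g(1) by blast
qed

section \<open>From normality to a frame of relations\<close>

text \<open>The counterpart of \<open>frame\<close> for relations: \<open>(F k, G k)\<close> is the
  Gale vector of \<open>k\<close> in coordinates where those of \<open>i\<close> and
  \<open>j\<close> are the unit vectors.\<close>

definition toric_frame :: "('n \<Rightarrow> int) set \<Rightarrow> 'n \<Rightarrow> 'n \<Rightarrow> ('n \<Rightarrow> int) \<Rightarrow> ('n \<Rightarrow> int) \<Rightarrow> bool" where
  "toric_frame L i j F G \<longleftrightarrow> F \<in> L \<and> G \<in> L \<and> F i = 1 \<and> F j = 0 \<and> G i = 0 \<and> G j = 1 \<and>
     (\<forall>u\<in>L. \<forall>k. u k = u i * F k + u j * G k) \<and>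
     (\<forall>k. F k \<le> 1 \<and> G k \<le> 1 \<and> \<not> (F k = 1 \<and> G k = 1))"

lemma real_column_nth [simp]: "real_column A j $ i = real_of_int (A $ i $ j)"
  by (simp add: real_column_def column_def map_matrix_def)

lemma sum_real_column:
  "(\<Sum>j\<in>UNIV. real_of_int (u j) *\<^sub>R real_column A j) = 0 \<longleftrightarrow> u \<in> relations A"
proof -
  have "(\<Sum>j\<in>UNIV. real_of_int (u j) *\<^sub>R real_column A j) $ i = real_of_int (\<Sum>j\<in>UNIV. A $ i $ j * u j)" for i
    by (simp add: mult.commute)
  then show ?thesis by (simp add: vec_eq_iff relations_def del: of_int_sum sum_component)
qed

text \<open>The bounds are read as coefficients of an integral combination of columns, and a real
  solution shows that it lies in the cone. The nonnegative integral representation given by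
  normality differs from it by a relation, whose coordinates are an integral solution.\<close>

lemma normal_integrally_feasible:
  assumes nrm: "normal_matrix A" and f: "f \<in> relations A" and g: "g \<in> relations A"
    and gen: "\<And>u. u \<in> relations A \<Longrightarrow> \<exists>s t. u = (\<lambda>j. s * f j + t * g j)"
  shows "integrally_feasible (range (\<lambda>j. (f j, g j)))"
  unfolding integrally_feasible_def
proof (intro allI impI, elim exE)
  fix p :: "int \<times> int \<Rightarrow> int" and s t :: real
  assume h: "\<forall>b\<in>range (\<lambda>j. (f j, g j)). of_int (fst b) * s + of_int (snd b) * t \<le> of_int (p b)"
  define q where "q j = p (f j, g j)" for j
  define r where "r j = real_of_int (q j) - (s * f j + t * g j)" for j
  let ?c = "real_column A"
  have fg: "(\<Sum>j\<in>UNIV. real_of_int (f j) *\<^sub>R ?c j) = 0" "(\<Sum>j\<in>UNIV. real_of_int (g j) *\<^sub>R ?c j) = 0"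
    using f g by (simp_all only: sum_real_column)
  have "(\<Sum>j\<in>UNIV. r j *\<^sub>R ?c j) = (\<Sum>j\<in>UNIV. real_of_int (q j) *\<^sub>R ?c j)
      - (s *\<^sub>R (\<Sum>j\<in>UNIV. real_of_int (f j) *\<^sub>R ?c j) + t *\<^sub>R (\<Sum>j\<in>UNIV. real_of_int (g j) *\<^sub>R ?c j))"
    by (simp add: r_def scaleR_sum_right sum.distrib[symmetric] sum_subtractf[symmetric] algebra_simps)
  then have eq: "(\<Sum>j\<in>UNIV. real_of_int (q j) *\<^sub>R ?c j) = (\<Sum>j\<in>UNIV. r j *\<^sub>R ?c j)"
    unfolding fg by simp
  have "r j \<ge> 0" for j using h by (auto simp: r_def q_def mult.commute)
  then have "(\<Sum>j\<in>UNIV. real_of_int (q j) *\<^sub>R ?c j) \<in> column_cone A"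
    unfolding eq column_cone_def by blast
  moreover have "(\<Sum>j\<in>UNIV. real_of_int (q j) *\<^sub>R ?c j) \<in> column_lattice A"
    unfolding column_lattice_def by blast
  ultimately have "(\<Sum>j\<in>UNIV. real_of_int (q j) *\<^sub>R ?c j) \<in> column_semigroup A"
    using nrm unfolding normal_matrix_def by blast
  then obtain m where m: "\<And>j. m j \<ge> 0"
    "(\<Sum>j\<in>UNIV. real_of_int (q j) *\<^sub>R ?c j) = (\<Sum>j\<in>UNIV. real_of_int (m j) *\<^sub>R ?c j)"
    unfolding column_semigroup_def by blast
  have "(\<Sum>j\<in>UNIV. real_of_int (q j - m j) *\<^sub>R ?c j) = 0"
    using m(2) by (simp add: sum_subtractf algebra_simps)
  then have "(\<lambda>j. q j - m j) \<in> relations A" unfolding sum_real_column .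
  then obtain s' t' where "(\<lambda>j. q j - m j) = (\<lambda>j. s' * f j + t' * g j)" using gen by blast
  then have qm: "q j - m j = s' * f j + t' * g j" for j by (rule fun_cong)
  have "f j * s' + g j * t' \<le> p (f j, g j)" for j
    using m(1)[of j] qm[of j] by (simp add: q_def mult.commute)
  then have "\<forall>b\<in>range (\<lambda>j. (f j, g j)). fst b * s' + snd b * t' \<le> p b" by auto
  then show "\<exists>s t. \<forall>b\<in>range (\<lambda>j. (f j, g j)). fst b * s + snd b * t \<le> p b" by blast
qed

text \<open>The coordinates of all Gale vectors with respect to \<open>v\<close>, \<open>w\<close>
  form two relations, obtained from \<open>f\<close>, \<open>g\<close> by a matrix of determinant
  1.\<close>

lemma toric_frame_of_frame:
  assumes fr: "frame (range (\<lambda>j. (f j, g j))) v w" and f: "f \<in> relations A" and g: "g \<in> relations A"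
    and gen: "\<And>u. u \<in> relations A \<Longrightarrow> \<exists>s t. u = (\<lambda>j. s * f j + t * g j)"
  shows "\<exists>i j F G. toric_frame (relations A) i j F G"
proof -
  let ?b = "\<lambda>k. (f k, g k)"
  obtain i j where ij: "v = ?b i" "w = ?b j" using fr by (auto simp: frame_def)
  define F where "F = (\<lambda>k. g j * f k + (- f j) * g k)"
  define G where "G = (\<lambda>k. - g i * f k + f i * g k)"
  have Fcr: "F k = det2 (?b k) w" and Gcr: "G k = det2 v (?b k)" for k
    by (simp_all add: F_def G_def ij det2_def algebra_simps)
  have det: "f i * g j - g i * f j = 1" using fr by (simp add: frame_def ij det2_def)
  have "F \<in> relations A" "G \<in> relations A" unfolding F_def G_def by (rule relations_comb[OF f g])+
  moreover have "F i = 1" "F j = 0" "G i = 0" "G j = 1"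
    using det by (simp_all add: F_def G_def algebra_simps)
  moreover have "u k = u i * F k + u j * G k" if uL: "u \<in> relations A" for u k
  proof -
    obtain s t where u: "u = (\<lambda>j. s * f j + t * g j)" using gen[OF uL] by blast
    have "u i * F k + u j * G k = (f i * g j - g i * f j) * u k"
      by (simp add: u F_def G_def algebra_simps)
    then show ?thesis by (simp add: det)
  qed
  moreover have "F k \<le> 1 \<and> G k \<le> 1 \<and> \<not> (F k = 1 \<and> G k = 1)" for k
    using fr unfolding Fcr Gcr frame_def by blast
  ultimately have "toric_frame (relations A) i j F G" unfolding toric_frame_def by blast
  then show ?thesis by blast
qed

text \<open>Nonnegative terms cannot cancel, so column \<open>k\<close> of \<open>A\<close>
  vanishes.\<close>

lemma nonnegative_relation_unit:
  assumes nn: "\<And>i j. 0 \<le> A $ i $ j" and u: "u \<in> relations A" "\<And>j. u j \<ge> 0" "u k > 0"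
  shows "(\<lambda>j. if j = k then 1 else 0) \<in> relations A"
proof -
  have "A $ i $ k = 0" for i
  proof -
    have "(\<Sum>j\<in>UNIV. A $ i $ j * u j) = 0" using u(1) by (simp add: relations_def)
    then have "\<forall>j\<in>UNIV. A $ i $ j * u j = 0"
      by (subst sum_nonneg_eq_0_iff[symmetric]) (use nn u in auto)
    then have "A $ i $ k * u k = 0" by blast
    then show ?thesis using u(3) by simp
  qed
  then show ?thesis by (simp add: relations_def if_distrib cong: if_cong)
qed

text \<open>
  If the Gale vectors do not positively span the plane, there is a nonzero nonnegative relation, and
  then some column of \<open>A\<close> is zero.
\<close>

lemma toric_frame_of_unit:
  fixes A :: "int^'n::finite^'d::finite"
  assumes N: "integrally_feasible (range (\<lambda>j. (f j, g j)))" and nn: "\<And>i j. 0 \<le> A $ i $ j"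
    and f: "f \<in> relations A" and g: "g \<in> relations A"
    and gen: "\<And>u. u \<in> relations A \<Longrightarrow> \<exists>s t. u = (\<lambda>j. s * f j + t * g j)"
    and ind: "\<And>s t. (\<lambda>j. s * f j + t * g j) = (\<lambda>_. 0) \<Longrightarrow> s = 0 \<and> t = 0"
    and unit: "(\<lambda>j. if j = k then 1 else 0) \<in> relations A"
  shows "\<exists>i j F G. toric_frame (relations A) i j F G"
proof -
  define e :: "'n \<Rightarrow> int" where "e = (\<lambda>j. if j = k then 1 else 0)"
  have eL: "e \<in> relations A" using unit by (simp add: e_def)
  obtain s t where e: "e = (\<lambda>j. s * f j + t * g j)" using gen[OF eL] by blast
  have ej: "e j = s * f j + t * g j" for j by (simp add: e)
  have ek: "s * f k + t * g k = 1" using ej[of k] by (simp add: e_def)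
  \<comment> \<open>\<open>F\<close> completes \<open>e\<close> to a basis of the relations. In this
    basis the Gale vector of \<open>k\<close> is \<open>(0, 1)\<close> and all others lie on the
    first axis, so only the entries of \<open>F\<close> matter.\<close>
  define F where "F = (\<lambda>j. g k * f j + (- f k) * g j)"
  have FL: "F \<in> relations A" unfolding F_def by (rule relations_comb[OF f g])
  have Fk: "F k = 0" by (simp add: F_def)
  have rep: "\<exists>c. \<forall>j. u j = c * F j + u k * e j" if uL: "u \<in> relations A" for u
  proof -
    obtain x y where u: "u = (\<lambda>j. x * f j + y * g j)" using gen[OF uL] by blast
    have "(x * t - y * s) * F j + u k * e j = (s * f k + t * g k) * u j" for j
      by (simp add: u ej F_def algebra_simps)
    then have "(x * t - y * s) * F j + u k * e j = u j" for j by (simp add: ek)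
    then show ?thesis by (intro exI[of _ "x * t - y * s"]) simp
  qed
  have F0: "\<exists>j. F j \<noteq> 0"
  proof (rule ccontr)
    assume "\<nexists>j. F j \<noteq> 0"
    then have "(\<lambda>j. g k * f j + (- f k) * g j) = (\<lambda>_. 0)" by (auto simp: F_def)
    then have "g k = 0 \<and> - f k = 0" by (rule ind)
    then show False using ek by simp
  qed
  have key: "\<exists>i j F G. toric_frame (relations A) i j F G"
    if H: "H = F \<or> H = (\<lambda>j. - F j)" and i: "H i = 1" and le: "\<And>j. H j \<le> 1" for H i
  proof -
    have HL: "H \<in> relations A" using H FL relations_comb[OF FL FL, of "-1" 0] by auto
    have Hk: "H k = 0" using H Fk by auto
    then have ik: "i \<noteq> k" using i by auto
    have "u j = u i * H j + u k * e j" if uL: "u \<in> relations A" for u j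
    proof -
      obtain c where c: "\<And>j. u j = c * F j + u k * e j" using rep[OF uL] by blast
      have "u i = c * F i" using c[of i] ik by (simp add: e_def)
      then have "u i * H j = c * F j" using H i by auto
      then show ?thesis using c[of j] by simp
    qed
    moreover have "e j \<le> 1 \<and> \<not> (H j = 1 \<and> e j = 1)" for j using Hk by (auto simp: e_def)
    ultimately have "toric_frame (relations A) i k H e"
      unfolding toric_frame_def using HL eL i Hk ik le by (auto simp: e_def)
    then show ?thesis by blast
  qed
  \<comment> \<open>If no entry of \<open>H\<close> is 1, its negative is a nonnegative relation and
    a second column of \<open>A\<close> is zero. The unit relation at that column forces
    \<open>F\<close> to be a unit vector up to sign.\<close>
  have key2: "\<exists>i j F G. toric_frame (relations A) i j F G"
    if H: "H = F \<or> H = (\<lambda>j. - F j)" and le: "\<And>j. H j \<le> 1" for H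
  proof (cases "\<exists>i. H i = 1")
    case True
    then show ?thesis using key[OF H _ le] by blast
  next
    case False
    have neg: "H j \<le> 0" for j
    proof -
      have "H j \<noteq> 1" using False by blast
      then show ?thesis using le[of j] by linarith
    qed
    have HL: "(\<lambda>j. - H j) \<in> relations A"
      using H FL relations_comb[OF FL FL, of "-1" 0] by auto
    obtain i where "F i \<noteq> 0" using F0 by blast
    then have i: "H i < 0" using neg[of i] H by auto
    have ik: "i \<noteq> k" using i H Fk by auto
    have "(\<lambda>j. if j = i then 1 else 0) \<in> relations A"
      by (rule nonnegative_relation_unit[OF nn HL, of i]) (use neg i in auto)
    then obtain c where c: "\<And>j. (if j = i then 1 else 0) = c * F j + (if k = i then 1 else 0) * e j"
      using rep by blast
    have cF: "c * F j = (if j = i then 1 else 0)" for j using c[of j] ik by simp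
    have Fi: "F i = 1 \<or> F i = -1" using cF[of i] by (auto simp: zmult_eq_1_iff)
    have "c \<noteq> 0" using cF[of i] by auto
    then have "F j = 0" if "j \<noteq> i" for j using cF[of j] that by simp
    then have F1: "F j = (if j = i then F i else 0)" for j by simp
    show ?thesis
    proof (cases "F i = 1")
      case True
      have "F j \<le> 1" for j using F1[of j] True by simp
      then show ?thesis using key[of F i] True by blast
    next
      case False
      have "- F j \<le> 1" for j using F1[of j] Fi False by simp
      then show ?thesis using key[of "\<lambda>j. - F j" i] False Fi by simp
    qed
  qed
  have "(\<forall>j. F j \<le> 1) \<or> (\<forall>j. - F j \<le> 1)"
  proof (rule ccontr)
    assume "\<not> ?thesis"
    then obtain p q where "\<not> F p \<le> 1" "\<not> - F q \<le> 1" by blast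
    then have pq: "F p \<ge> 2" "F q \<le> -2" by linarith+
    have pk: "p \<noteq> k" "q \<noteq> k" using pq Fk by auto
    \<comment> \<open>In these coordinates the Gale vectors of \<open>p\<close> and \<open>q\<close>
      are opposite multiples of the first unit vector, by factors of absolute value at least
      2.\<close>
    let ?T = "lin2 (g k) (- f k) s t"
    have N': "integrally_feasible (?T ` range (\<lambda>j. (f j, g j)))"
      by (rule integrally_feasible_lin2[OF N]) (use ek in \<open>simp add: algebra_simps\<close>)
    have m: "(F j, e j) \<in> ?T ` range (\<lambda>j. (f j, g j))" for j
      by (rule image_eqI[of _ _ "(f j, g j)"]) (auto simp: lin2_def F_def ej)
    have "(F p * 1, F p * 0) \<in> ?T ` range (\<lambda>j. (f j, g j))"
      "(- (- F q) * 1, - (- F q) * 0) \<in> ?T ` range (\<lambda>j. (f j, g j))"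
      using m[of p] m[of q] pk by (simp_all add: e_def)
    then show False by (rule no_bad_opposite[OF N']) (use pq in auto)
  qed
  then show ?thesis using key2[of F] key2[of "\<lambda>j. - F j"] by auto
qed

lemma toric_frame_exists:
  fixes A :: "int^'n::finite^'d::finite"
  assumes nn: "\<And>i j. 0 \<le> A $ i $ j" and rk: "rank (map_matrix real_of_int A) = CARD('d)"
    and card: "CARD('n) = CARD('d) + 2" and nrm: "normal_matrix A"
  shows "\<exists>i j F G. toric_frame (relations A) i j F G"
proof -
  obtain f g where f: "f \<in> relations A" and g: "g \<in> relations A"
    and gen: "\<And>u. u \<in> relations A \<Longrightarrow> \<exists>s t. u = (\<lambda>j. s * f j + t * g j)"
    and ind: "\<And>s t. (\<lambda>j. s * f j + t * g j) = (\<lambda>_. 0) \<Longrightarrow> s = 0 \<and> t = 0"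
    using relations_basis[OF rk card] by (elim exE conjE) blast
  let ?S = "range (\<lambda>j. (f j, g j))"
  have N: "integrally_feasible ?S" by (rule normal_integrally_feasible[OF nrm f g gen])
  show ?thesis
  proof (cases "\<exists>u\<in>relations A. (\<forall>j. u j \<ge> 0) \<and> (\<exists>k. u k > 0)")
    case True
    then obtain u k where "u \<in> relations A" "\<And>j. u j \<ge> 0" "u k > 0" by blast
    then have "(\<lambda>j. if j = k then 1 else 0 :: int) \<in> relations A"
      using nonnegative_relation_unit[OF nn] by blast
    then show ?thesis by (intro toric_frame_of_unit[OF N nn f g gen ind])
  next
    case False
    have "\<exists>v w. frame ?S v w"
    proof (rule frame_of_spanning[OF N])
      show "\<exists>b\<in>?S. fst b * s + snd b * t > 0" if "(s, t) \<noteq> (0, 0)" for s t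
      proof (rule ccontr)
        assume neg: "\<not> ?thesis"
        \<comment> \<open>If no Gale vector is positive under \<open>(s, t)\<close>, the negated
          combination is a nonnegative relation. It is zero in this case, against
          independence.\<close>
        define u where "u = (\<lambda>j. - s * f j + - t * g j)"
        have uL: "u \<in> relations A" unfolding u_def by (rule relations_comb[OF f g])
        have le: "s * f j + t * g j \<le> 0" for j
          using neg by (force simp: not_less mult.commute)
        have nonneg: "u j \<ge> 0" for j using le[of j] by (simp add: u_def)
        have "u = (\<lambda>_. 0)"
        proof
          fix k
          have "\<not> u k > 0" using False uL nonneg by blast
          then show "u k = 0" using nonneg[of k] by linarith
        qed
        then have "- s = 0 \<and> - t = 0" unfolding u_def by (rule ind)
        then show False using that by simp
      qed
    qed simp
    then show ?thesis using toric_frame_of_frame[OF _ f g gen] by blast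
  qed
qed

subsection \<open>Monomials, ideals and term orders\<close>

definition mon :: "('n::finite \<Rightarrow> nat) \<Rightarrow> 'n monomial" where
  "mon u = Abs_poly_mapping u"

lemma exponent_mon [simp]: "exponent (mon u) = u"
  unfolding mon_def by (rule Abs_poly_mapping_inverse) simp

definition pos_part :: "('n::finite \<Rightarrow> int) \<Rightarrow> 'n monomial" where
  "pos_part u = mon (\<lambda>k. nat (u k))"

definition neg_part :: "('n::finite \<Rightarrow> int) \<Rightarrow> 'n monomial" where
  "neg_part u = mon (\<lambda>k. nat (- u k))"

definition lattice_binomial :: "('n::finite \<Rightarrow> int) \<Rightarrow> ('n, 'k::field) mpoly" where
  "lattice_binomial u = xpow (pos_part u) - xpow (neg_part u)"

lemma exponent_pos_part [simp]: "exponent (pos_part u) k = nat (u k)"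
  and exponent_neg_part [simp]: "exponent (neg_part u) k = nat (- u k)"
  by (simp_all add: pos_part_def neg_part_def)

lemma monomial_eqI: "(\<And>k. exponent s k = exponent t k) \<Longrightarrow> s = t"
  by (rule poly_mapping_eqI)

lemma monomial_dvd_iff: "monomial_dvd s t \<longleftrightarrow> (\<forall>k. exponent s k \<le> exponent t k)"
  for s t :: "'n::finite monomial"
proof
  assume "monomial_dvd s t"
  then show "\<forall>k. exponent s k \<le> exponent t k" by (auto simp: monomial_dvd_def lookup_add)
next
  assume le: "\<forall>k. exponent s k \<le> exponent t k"
  have "t = s + mon (\<lambda>k. exponent t k - exponent s k)"
    by (rule monomial_eqI) (use le in \<open>simp add: lookup_add\<close>)
  then show "monomial_dvd s t" unfolding monomial_dvd_def by blast
qed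

lemma xpow_add: "xpow (s + t) = (xpow s * xpow t :: ('n, 'k::field) mpoly)"
  by (simp add: xpow_def mult_single)

lemma keys_xpow_diff: "s \<noteq> t \<Longrightarrow> Poly_Mapping.keys (xpow s - xpow t :: ('n, 'k::field) mpoly) = {s, t}"
  by (auto simp: xpow_def in_keys_iff lookup_minus lookup_single when_def split: if_splits)

lemmas ideal_gen_base = module.span_base[OF module_mult, folded ideal_gen_def]
lemmas ideal_gen_zero = module.span_zero[OF module_mult, folded ideal_gen_def]
lemmas ideal_gen_add = module.span_add[OF module_mult, folded ideal_gen_def]
lemmas ideal_gen_neg = module.span_neg[OF module_mult, folded ideal_gen_def]
lemmas ideal_gen_mult = module.span_scale[OF module_mult, folded ideal_gen_def]
lemmas ideal_gen_mono = module.span_mono[OF module_mult, folded ideal_gen_def]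
lemmas ideal_gen_induct [consumes 1, case_names base step] = module.span_induct_alt[OF module_mult, folded ideal_gen_def]

lemma ideal_gen_least:
  assumes "G \<subseteq> ideal_gen H"
  shows "ideal_gen G \<subseteq> ideal_gen H"
proof
  fix x assume "x \<in> ideal_gen G"
  then show "x \<in> ideal_gen H"
  proof (induction rule: ideal_gen_induct)
    case base
    show ?case by (rule ideal_gen_zero)
  next
    case (step c x y)
    then show ?case using assms by (blast intro: ideal_gen_add ideal_gen_mult)
  qed
qed

section \<open>Linear functionals vanishing on binomial ideals\<close>

definition pairing :: "('n monomial \<Rightarrow> 'k) \<Rightarrow> ('n, 'k::field) mpoly \<Rightarrow> 'k" where
  "pairing h f = (\<Sum>t\<in>Poly_Mapping.keys f. Poly_Mapping.lookup f t * h t)"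

lemma pairing_superset:
  "finite K \<Longrightarrow> Poly_Mapping.keys f \<subseteq> K \<Longrightarrow> pairing h f = (\<Sum>t\<in>K. Poly_Mapping.lookup f t * h t)"
  unfolding pairing_def by (rule sum.mono_neutral_left) (auto simp: in_keys_iff)

lemma pairing_zero [simp]: "pairing h 0 = 0"
  by (simp add: pairing_def)

lemma pairing_add: "pairing h (f + g) = pairing h f + pairing h g"
proof -
  let ?K = "Poly_Mapping.keys f \<union> Poly_Mapping.keys g"
  have "pairing h (f + g) = (\<Sum>t\<in>?K. Poly_Mapping.lookup (f + g) t * h t)"
    by (rule pairing_superset) (simp_all add: keys_add)
  moreover have "pairing h f = (\<Sum>t\<in>?K. Poly_Mapping.lookup f t * h t)"
    "pairing h g = (\<Sum>t\<in>?K. Poly_Mapping.lookup g t * h t)"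
    by (rule pairing_superset; simp)+
  ultimately show ?thesis by (simp add: lookup_add distrib_right sum.distrib)
qed

lemma pairing_single: "pairing h (Poly_Mapping.single t c) = c * h t"
  by (simp add: pairing_def)

lemma pairing_diff: "pairing h (f - g) = pairing h f - pairing h g"
  using pairing_add[of h "f - g" g] by simp

lemma pairing_mult_binomial:
  assumes "\<And>t. h (t + p) = h (t + q)"
  shows "pairing h (c * (xpow p - xpow q)) = 0"
proof (induction c rule: update_induct)
  case const
  show ?case by simp
next
  case (update f a b)
  have "Poly_Mapping.update a b f = Poly_Mapping.single a b + f"
    using update(1)
    by (intro poly_mapping_eqI) (auto simp: lookup_update lookup_add lookup_single when_def in_keys_iff)
  moreover have "pairing h (Poly_Mapping.single a b * (xpow p - xpow q)) = 0"
    using assms[of a] by (simp add: xpow_def right_diff_distrib mult_single pairing_diff pairing_single)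
  ultimately show ?case using update(3) by (simp add: distrib_right pairing_add)
qed

text \<open>Such a functional kills every multiple of every generator. It is applied to the
  indicator of a fibre and to evaluation at a 0/1 point.\<close>

lemma pairing_ideal:
  assumes f: "f \<in> ideal_gen {xpow p - xpow q | p q. R p q}"
    and h: "\<And>p q t. R p q \<Longrightarrow> h (t + p) = h (t + q)"
  shows "pairing h f = 0"
  using f
proof (induction rule: ideal_gen_induct)
  case base
  show ?case by simp
next
  case (step c x y)
  then obtain p q where "R p q" "x = xpow p - xpow q" by blast
  then have "pairing h (c * x) = 0" using pairing_mult_binomial[of h p q c] h by blast
  then show ?case using step.IH by (simp add: pairing_add)
qed

section \<open>Term orders from weight sequences\<close>

definition lex_le :: "('a \<Rightarrow> nat \<Rightarrow> nat) \<Rightarrow> 'a \<Rightarrow> 'a \<Rightarrow> bool" where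
  "lex_le \<phi> s t \<longleftrightarrow> s = t \<or> (\<exists>k. (\<forall>m<k. \<phi> s m = \<phi> t m) \<and> \<phi> s k < \<phi> t k)"

text \<open>Additivity gives compatibility with products, injectivity gives totality, and the
  monomial 1 is least because all its weights are 0.\<close>

lemma term_order_lex_le:
  fixes \<phi> :: "'n monomial \<Rightarrow> nat \<Rightarrow> nat"
  assumes add: "\<And>s t k. \<phi> (s + t) k = \<phi> s k + \<phi> t k" and inj: "inj \<phi>"
  shows "term_order (lex_le \<phi>)"
proof -
  define lt where "lt s t \<longleftrightarrow> (\<exists>k. (\<forall>m<k. \<phi> s m = \<phi> t m) \<and> \<phi> s k < \<phi> t k)" for s t
  have irr: "\<not> lt s s" for s by (simp add: lt_def)
  have trans: "lt s u" if st: "lt s t" "lt t u" for s t u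
  proof -
    obtain k l where k: "\<forall>m<k. \<phi> s m = \<phi> t m" "\<phi> s k < \<phi> t k"
      and l: "\<forall>m<l. \<phi> t m = \<phi> u m" "\<phi> t l < \<phi> u l" using st by (auto simp: lt_def)
    have "(\<forall>m<min k l. \<phi> s m = \<phi> u m) \<and> \<phi> s (min k l) < \<phi> u (min k l)"
      using k l by (cases k l rule: linorder_cases) (auto simp: min_def)
    then show ?thesis unfolding lt_def by blast
  qed
  have tri: "lt s t \<or> s = t \<or> lt t s" for s t
  proof (cases "s = t")
    case False
    then have "\<phi> s \<noteq> \<phi> t" using injD[OF inj] by blast
    then have "\<exists>k. \<phi> s k \<noteq> \<phi> t k" by (simp add: fun_eq_iff)
    then obtain k where k: "\<phi> s k \<noteq> \<phi> t k" "\<And>m. m < k \<Longrightarrow> \<phi> s m = \<phi> t m"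
      using exists_least_iff[of "\<lambda>k. \<phi> s k \<noteq> \<phi> t k"] by blast
    consider "\<phi> s k < \<phi> t k" | "\<phi> t k < \<phi> s k" using k(1) by linarith
    then show ?thesis
    proof cases
      case 1
      then have "lt s t" unfolding lt_def using k(2) by blast
      then show ?thesis by blast
    next
      case 2
      then have "lt t s" unfolding lt_def using k(2) by (intro exI[of _ k]) simp
      then show ?thesis by blast
    qed
  qed simp
  have le: "lex_le \<phi> s t \<longleftrightarrow> lt s t \<or> s = t" for s t by (auto simp: lex_le_def lt_def)
  have lt: "(\<lambda>s t. lex_le \<phi> s t \<and> s \<noteq> t) = lt" using irr by (auto simp: le fun_eq_iff)
  have "class.order (lex_le \<phi>) lt"
    by (rule order_strictI) (use le irr trans in blast)+
  then have "class.linorder (lex_le \<phi>) lt" by (rule linorder_strictI) (rule tri)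
  moreover have "lex_le \<phi> 0 t" for t
  proof (cases "t = 0")
    case False
    have z: "\<phi> 0 k = 0" for k using add[of 0 0 k] by simp
    have "\<not> lt t 0" by (simp add: lt_def z)
    then show ?thesis using tri[of 0 t] le by blast
  qed (simp add: le)
  moreover have "lex_le \<phi> (s + u) (t + u)" if "lex_le \<phi> s t" for s t u
    using that by (auto simp: lex_le_def add)
  ultimately show ?thesis unfolding term_order_def lt by blast
qed

lemma lead_monomialI:
  assumes to: "term_order le" and "t \<in> Poly_Mapping.keys f" "\<And>s. s \<in> Poly_Mapping.keys f \<Longrightarrow> le s t"
  shows "lead_monomial le f = t"
proof -
  interpret lo: linorder le "\<lambda>s t. le s t \<and> s \<noteq> t" using to by (simp add: term_order_def)
  show ?thesis unfolding lead_monomial_def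
  proof (rule the_equality)
    show "t \<in> Poly_Mapping.keys f \<and> (\<forall>s\<in>Poly_Mapping.keys f. le s t)" using assms(2,3) by blast
    show "u = t" if "u \<in> Poly_Mapping.keys f \<and> (\<forall>s\<in>Poly_Mapping.keys f. le s u)" for u
      by (rule lo.order.antisym) (use that assms(2,3) in blast)+
  qed
qed

lemma lead_monomial:
  assumes to: "term_order le" and f: "f \<noteq> 0"
  shows "lead_monomial le f \<in> Poly_Mapping.keys f"
    and "s \<in> Poly_Mapping.keys f \<Longrightarrow> le s (lead_monomial le f)"
proof -
  interpret lo: linorder le "\<lambda>s t. le s t \<and> s \<noteq> t" using to by (simp add: term_order_def)
  have ex: "\<exists>t\<in>K. \<forall>s\<in>K. le s t" if "finite K" "K \<noteq> {}" for K
    using that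
  proof (induction K rule: finite_ne_induct)
    case (insert x K)
    then obtain t where t: "t \<in> K" "\<forall>s\<in>K. le s t" by blast
    consider "le x t" | "le t x" using lo.linear by blast
    then show ?case
    proof cases
      case 1
      then show ?thesis using t by auto
    next
      case 2
      then have "\<forall>s\<in>insert x K. le s x" using t lo.order.trans lo.order.refl by blast
      then show ?thesis by blast
    qed
  qed auto
  have "Poly_Mapping.keys f \<noteq> {}" using f by simp
  then obtain t where t: "t \<in> Poly_Mapping.keys f" "\<forall>s\<in>Poly_Mapping.keys f. le s t"
    using ex[OF finite_keys] by blast
  then have "lead_monomial le f = t" by (intro lead_monomialI[OF to]) auto
  then show "lead_monomial le f \<in> Poly_Mapping.keys f"
    and "s \<in> Poly_Mapping.keys f \<Longrightarrow> le s (lead_monomial le f)" using t by simp_all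
qed

subsection \<open>Groebner bases of toric ideals\<close>

text \<open>The positions after 0 only break ties: for injective \<open>e\<close> each of their sums
  has at most one term, so together they list all exponents.\<close>

definition weight_seq :: "('n::finite \<Rightarrow> nat) \<Rightarrow> 'n \<Rightarrow> 'n \<Rightarrow> 'n monomial \<Rightarrow> nat \<Rightarrow> nat" where
  "weight_seq e i j t k = (case k of 0 \<Rightarrow> exponent t i + exponent t j
     | Suc m \<Rightarrow> (\<Sum>x | e x = m. exponent t x))"

lemma weight_seq_add: "weight_seq e i j (s + t) k = weight_seq e i j s k + weight_seq e i j t k"
  by (simp add: weight_seq_def lookup_add sum.distrib split: nat.split)

lemma inj_weight_seq:
  assumes "inj e"
  shows "inj (weight_seq e i j)"
proof (rule injI)
  fix s t assume eq: "weight_seq e i j s = weight_seq e i j t"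
  have "{y. e y = e x} = {x}" for x using injD[OF assms] by blast
  then have "weight_seq e i j u (Suc (e x)) = exponent u x" for u x by (simp add: weight_seq_def)
  then show "s = t" using fun_cong[OF eq] by (metis monomial_eqI)
qed

lemma matrix_eq_iff_relation:
  "A *v (\<chi> j. int (exponent p j)) = A *v (\<chi> j. int (exponent q j)) \<longleftrightarrow>
     (\<lambda>j. int (exponent p j) - int (exponent q j)) \<in> relations A"
  by (simp add: vec_eq_iff matrix_vector_mult_def relations_def right_diff_distrib sum_subtractf)

lemma toric_ideal_eq:
  "toric_ideal A = ideal_gen {xpow p - xpow q | p q.
     (\<lambda>j. int (exponent p j) - int (exponent q j)) \<in> relations A}"
  by (simp add: toric_ideal_def matrix_eq_iff_relation)

lemma pos_part_minus_neg_part: "int (exponent (pos_part u) k) - int (exponent (neg_part u) k) = u k"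
  by simp

lemma pos_part_ne_neg_part:
  assumes "u \<noteq> (\<lambda>_. 0)"
  shows "pos_part u \<noteq> neg_part u"
proof
  assume "pos_part u = neg_part u"
  then have "u k = 0" for k using pos_part_minus_neg_part[of u k] by simp
  then show False using assms by auto
qed

text \<open>
  In the last hypothesis, \<open>Z\<close> is the set of vanishing coordinates of a 0/1 point at which the binomial
  of \<open>m\<close> is nonzero while all other binomials vanish. The leading monomials are recognised by the
  functionals summing the coefficients over a fibre, which vanish on the toric ideal.
\<close>

lemma toric_groebner_basis:
  fixes A :: "int^'n::finite^'d::finite" and U :: "('n \<Rightarrow> int) set"
  assumes finU: "finite U" and UL: "U \<subseteq> relations A"
    and wt: "\<And>u. u \<in> U \<Longrightarrow> u i + u j > 0" and le1: "\<And>u k. u \<in> U \<Longrightarrow> u k \<le> 1"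
    and cover: "\<And>u. u \<in> relations A \<Longrightarrow> u i + u j \<ge> 0 \<Longrightarrow> u \<noteq> (\<lambda>_. 0) \<Longrightarrow>
      \<exists>m\<in>U. \<forall>k. m k > 0 \<longrightarrow> u k > 0"
    and reduced: "\<And>m n. m \<in> U \<Longrightarrow> n \<in> U \<Longrightarrow> m \<noteq> n \<Longrightarrow>
      (\<exists>k. m k > 0 \<and> n k \<le> 0) \<and> (\<exists>k. m k > 0 \<and> n k \<ge> 0)"
    and minimal: "\<And>m. m \<in> U \<Longrightarrow> \<exists>Z. ((\<exists>k\<in>Z. m k > 0) \<noteq> (\<exists>k\<in>Z. m k < 0)) \<and>
      (\<forall>n\<in>U. n \<noteq> m \<longrightarrow> (\<exists>k\<in>Z. n k > 0) = (\<exists>k\<in>Z. n k < 0))"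
  shows "\<exists>le. term_order le \<and>
    (\<exists>S. (\<forall>t\<in>S. squarefree_monomial t) \<and>
         initial_ideal le (toric_ideal A :: ('n, 'k::field) mpoly set) = ideal_gen (xpow ` S)) \<and>
    (\<exists>G. reduced_groebner_basis le (toric_ideal A :: ('n, 'k) mpoly set) G \<and>
         minimal_generating_set G (toric_ideal A))"
proof -
  let ?I = "toric_ideal A :: ('n, 'k) mpoly set"
  let ?L = "relations A"
  let ?G = "lattice_binomial ` U :: ('n, 'k) mpoly set"
  let ?w = "\<lambda>t :: 'n monomial. exponent t i + exponent t j"
  obtain e :: "'n \<Rightarrow> nat" where e: "inj e"
    using finite_imp_inj_to_nat_seg[OF finite[of "UNIV :: 'n set"]] by blast
  define le where "le = lex_le (weight_seq e i j)"
  have to: "term_order le"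
    unfolding le_def by (rule term_order_lex_le[OF weight_seq_add inj_weight_seq[OF e]])
  have le_w: "le s t" if "?w s < ?w t" for s t
    unfolding le_def lex_le_def using that by (intro disjI2 exI[of _ 0]) (simp add: weight_seq_def)
  have w_le: "?w s \<le> ?w t" if "le s t" for s t
  proof (cases "s = t")
    case False
    then obtain k where k: "\<forall>m<k. weight_seq e i j s m = weight_seq e i j t m"
      "weight_seq e i j s k < weight_seq e i j t k"
      using \<open>le s t\<close> unfolding le_def lex_le_def by blast
    have "weight_seq e i j s 0 \<le> weight_seq e i j t 0" using k by (cases k) auto
    then show ?thesis by (simp add: weight_seq_def)
  qed simp
  have nz: "m \<noteq> (\<lambda>_. 0)" if "m \<in> U" for m using wt[OF that] by auto
  have ne: "pos_part m \<noteq> neg_part m" if "m \<in> U" for m using pos_part_ne_neg_part[OF nz[OF that]] .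
  have keys: "Poly_Mapping.keys (lattice_binomial m :: ('n, 'k) mpoly) = {pos_part m, neg_part m}" if "m \<in> U" for m
    unfolding lattice_binomial_def by (rule keys_xpow_diff[OF ne[OF that]])
  have wlt: "?w (neg_part m) < ?w (pos_part m)" if "m \<in> U" for m
    using wt[OF that] by simp
  have refl: "le t t" for t by (simp add: le_def lex_le_def)
  have lead: "lead_monomial le (lattice_binomial m :: ('n, 'k) mpoly) = pos_part m" if "m \<in> U" for m
    by (rule lead_monomialI[OF to]) (use keys[OF that] le_w[OF wlt[OF that]] refl in auto)
  have inI: "lattice_binomial m \<in> ?I" if "m \<in> U" for m
  proof -
    have "(\<lambda>k. int (exponent (pos_part m) k) - int (exponent (neg_part m) k)) \<in> ?L"
      unfolding pos_part_minus_neg_part using that UL by blast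
    then show ?thesis unfolding toric_ideal_eq lattice_binomial_def by (intro ideal_gen_base) blast
  qed
  \<comment> \<open>The cover hypothesis only concerns signs. As the entries of \<open>m\<close> are
    at most 1, positivity already yields divisibility.\<close>
  have red: "\<exists>m\<in>U. monomial_dvd (pos_part m) p"
    if pq: "(\<lambda>k. int (exponent p k) - int (exponent q k)) \<in> ?L" "p \<noteq> q" "?w q \<le> ?w p" for p q
  proof -
    have nz: "(\<lambda>k. int (exponent p k) - int (exponent q k)) \<noteq> (\<lambda>_. 0)"
      using pq(2) by (auto simp: fun_eq_iff intro!: monomial_eqI)
    have "\<exists>m\<in>U. \<forall>k. m k > 0 \<longrightarrow> int (exponent p k) - int (exponent q k) > 0"
      by (rule cover[OF pq(1) _ nz]) (use pq(3) in simp)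
    then obtain m where m: "m \<in> U" "\<And>k. m k > 0 \<Longrightarrow> int (exponent p k) - int (exponent q k) > 0" by blast
    have "exponent (pos_part m) k \<le> exponent p k" for k
      using m(2)[of k] le1[OF m(1), of k] by (cases "m k > 0") auto
    then show ?thesis using m(1) unfolding monomial_dvd_iff by blast
  qed
  \<comment> \<open>Replacing the positive by the negative part of some \<open>m\<close> in the
    heavier monomial lowers its weight strictly, so the total weight of both monomials serves as
    induction measure.\<close>
  have gen: "xpow p - xpow q \<in> ideal_gen ?G"
    if pq: "(\<lambda>k. int (exponent p k) - int (exponent q k)) \<in> ?L" for p q
    using pq
  proof (induction "?w p + ?w q" arbitrary: p q rule: less_induct)
    case less
    have step: "xpow p' - xpow q' \<in> ideal_gen ?G"
      if h: "(\<lambda>k. int (exponent p' k) - int (exponent q' k)) \<in> ?L" "?w q' \<le> ?w p'"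
        "?w p' + ?w q' = ?w p + ?w q" for p' q'
    proof (cases "p' = q'")
      case True
      then show ?thesis using ideal_gen_zero by simp
    next
      case False
      obtain m r where m: "m \<in> U" and r: "p' = pos_part m + r"
        using red[OF h(1) False h(2)] unfolding monomial_dvd_def by blast
      let ?p = "neg_part m + r"
      have exp: "int (exponent ?p k) - int (exponent q' k)
          = 1 * (int (exponent p' k) - int (exponent q' k)) + (-1) * m k" for k
        by (simp add: r lookup_add)
      have "(\<lambda>k. 1 * (int (exponent p' k) - int (exponent q' k)) + (-1) * m k) \<in> ?L"
        by (rule relations_comb[OF h(1)]) (use m UL in blast)
      then have L: "(\<lambda>k. int (exponent ?p k) - int (exponent q' k)) \<in> ?L" unfolding exp .
      have "?w ?p < ?w p'" using wlt[OF m] unfolding r lookup_add by linarith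
      then have "xpow ?p - xpow q' \<in> ideal_gen ?G" using h(3) by (intro less.hyps[OF _ L]) linarith
      moreover have "xpow r * lattice_binomial m \<in> ideal_gen ?G"
        using m by (intro ideal_gen_mult ideal_gen_base) blast
      ultimately have "xpow r * lattice_binomial m + (xpow ?p - xpow q') \<in> ideal_gen ?G"
        by (intro ideal_gen_add)
      also have "xpow r * lattice_binomial m + (xpow ?p - xpow q') = (xpow p' - xpow q' :: ('n, 'k) mpoly)"
        by (simp add: r lattice_binomial_def xpow_add algebra_simps)
      finally show ?thesis .
    qed
    show ?case
    proof (cases "?w q \<le> ?w p")
      case True
      then show ?thesis using step[OF less.prems] by simp
    next
      case False
      have "(\<lambda>k. (-1) * (int (exponent p k) - int (exponent q k)) + 0 * (int (exponent p k) - int (exponent q k))) \<in> ?L"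
        by (rule relations_comb[OF less.prems less.prems])
      then have "(\<lambda>k. int (exponent q k) - int (exponent p k)) \<in> ?L" by simp
      then have "xpow q - xpow p \<in> ideal_gen ?G" using step[of q p] False by simp
      then have "- (xpow q - xpow p) \<in> ideal_gen ?G" by (rule ideal_gen_neg)
      then show ?thesis by simp
    qed
  qed
  have IG: "ideal_gen ?G = ?I"
  proof
    show "ideal_gen ?G \<subseteq> ?I" using inI unfolding toric_ideal_eq by (intro ideal_gen_least) blast
    show "?I \<subseteq> ideal_gen ?G" unfolding toric_ideal_eq by (rule ideal_gen_least) (use gen in blast)
  qed
  have lead_red: "\<exists>m\<in>U. monomial_dvd (pos_part m) (lead_monomial le f)" if f: "f \<in> ?I" "f \<noteq> 0" for f
  proof -
    define t where "t = lead_monomial le f"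
    have t: "t \<in> Poly_Mapping.keys f" "\<And>s. s \<in> Poly_Mapping.keys f \<Longrightarrow> le s t"
      unfolding t_def using lead_monomial[OF to f(2)] by blast+
    \<comment> \<open>The indicator of the fibre of \<open>t\<close>. The coefficients of
      \<open>f\<close> over this fibre sum to 0, so \<open>f\<close> has another monomial there, of
      no larger weight, and \<open>red\<close> applies to the pair.\<close>
    define h :: "'n monomial \<Rightarrow> 'k" where
      "h s = (if (\<lambda>k. int (exponent t k) - int (exponent s k)) \<in> ?L then 1 else 0)" for s
    have h0: "h t = 1" by (simp add: h_def relations_def)
    have shift: "h (r + p) = h (r + q)"
      if pq: "(\<lambda>k. int (exponent p k) - int (exponent q k)) \<in> ?L" for p q r
    proof -
      have 1: "(\<lambda>k. 1 * (int (exponent t k) - int (exponent (r + p) k)) + 1 * (int (exponent p k) - int (exponent q k)))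
        = (\<lambda>k. int (exponent t k) - int (exponent (r + q) k))"
        and 2: "(\<lambda>k. 1 * (int (exponent t k) - int (exponent (r + q) k)) + (-1) * (int (exponent p k) - int (exponent q k)))
        = (\<lambda>k. int (exponent t k) - int (exponent (r + p) k))"
        by (auto simp: lookup_add fun_eq_iff)
      show ?thesis unfolding h_def
        using relations_comb[OF _ pq, of "\<lambda>k. int (exponent t k) - int (exponent (r + p) k)" 1 1]
          relations_comb[OF _ pq, of "\<lambda>k. int (exponent t k) - int (exponent (r + q) k)" 1 "-1"]
        unfolding 1 2 by auto
    qed
    have "pairing h f = 0"
      by (rule pairing_ideal[OF f(1)[unfolded toric_ideal_eq]]) (rule shift)
    moreover have "pairing h f = Poly_Mapping.lookup f t * h t
        + (\<Sum>s\<in>Poly_Mapping.keys f - {t}. Poly_Mapping.lookup f s * h s)"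
      unfolding pairing_def by (rule sum.remove) (use t in auto)
    ultimately have "(\<Sum>s\<in>Poly_Mapping.keys f - {t}. Poly_Mapping.lookup f s * h s) \<noteq> 0"
      using t(1) h0 by (auto simp: in_keys_iff)
    then obtain s where s: "s \<in> Poly_Mapping.keys f - {t}" "Poly_Mapping.lookup f s * h s \<noteq> 0"
      by (rule sum.not_neutral_contains_not_neutral)
    then have "(\<lambda>k. int (exponent t k) - int (exponent s k)) \<in> ?L" by (auto simp: h_def split: if_splits)
    then show ?thesis using red[of t s] s(1) w_le[OF t(2)[of s]] unfolding t_def by blast
  qed
  define S where "S = pos_part ` U"
  have leadset: "{xpow (lead_monomial le g) | g. g \<in> ?G} = (xpow ` S :: ('n, 'k) mpoly set)"
    unfolding S_def Setcompr_eq_image image_image by (rule image_cong) (simp_all add: lead)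
  have init: "initial_ideal le ?I = ideal_gen (xpow ` S)"
  proof
    show "initial_ideal le ?I \<subseteq> ideal_gen (xpow ` S)"
      unfolding initial_ideal_def
    proof (rule ideal_gen_least, rule subsetI)
      fix x :: "('n, 'k) mpoly" assume "x \<in> {xpow (lead_monomial le f) | f. f \<in> ?I \<and> f \<noteq> 0}"
      then obtain f where f: "f \<in> ?I" "f \<noteq> 0" "x = xpow (lead_monomial le f)" by blast
      obtain m r where "m \<in> U" "lead_monomial le f = pos_part m + r"
        using lead_red[OF f(1,2)] unfolding monomial_dvd_def by blast
      then have x: "x = xpow r * xpow (pos_part m)" and "xpow (pos_part m) \<in> (xpow ` S :: ('n, 'k) mpoly set)"
        using f(3) by (simp_all add: xpow_add mult.commute S_def)
      then show "x \<in> ideal_gen (xpow ` S)" unfolding x by (intro ideal_gen_mult ideal_gen_base)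
    qed
    have "lattice_binomial m \<noteq> (0 :: ('n, 'k) mpoly)" if "m \<in> U" for m using keys[OF that] by auto
    then show "ideal_gen (xpow ` S) \<subseteq> initial_ideal le ?I"
      unfolding initial_ideal_def leadset[symmetric] using inI by (intro ideal_gen_mono) blast
  qed
  have sqf: "\<forall>t\<in>S. squarefree_monomial t"
    unfolding S_def squarefree_monomial_def using le1 by (auto simp: nat_le_iff)
  have G0: "0 \<notin> ?G" using keys by force
  have gb: "groebner_basis le ?I ?G"
    unfolding groebner_basis_def leadset using finU inI G0 init by blast
  have lc: "lead_coefficient le g = 1" if g: "g \<in> ?G" for g
  proof -
    obtain m where m: "m \<in> U" "g = lattice_binomial m" using g by blast
    show ?thesis unfolding lead_coefficient_def m(2) lead[OF m(1)]
      using ne[OF m(1)] by (simp add: lattice_binomial_def xpow_def lookup_minus lookup_single)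
  qed
  have rgb: "reduced_groebner_basis le ?I ?G"
    unfolding reduced_groebner_basis_def
  proof (intro conjI ballI impI gb lc)
    fix g h t assume "g \<in> ?G" "h \<in> ?G" "g \<noteq> h" and t: "t \<in> Poly_Mapping.keys h"
    then obtain m n where mn: "m \<in> U" "n \<in> U" "m \<noteq> n" "g = lattice_binomial m" "h = lattice_binomial n" by blast
    \<comment> \<open>Both variables divide the leading monomial of \<open>g\<close>;
      \<open>k\<close> is missing from the positive part of \<open>n\<close> and \<open>l\<close>
      from its negative part.\<close>
    obtain k l where k: "m k > 0" "n k \<le> 0" and l: "m l > 0" "n l \<ge> 0" using reduced[OF mn(1-3)] by blast
    have "t = pos_part n \<or> t = neg_part n" using t keys[OF mn(2)] mn(5) by simp
    then show "\<not> monomial_dvd (lead_monomial le g) t"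
    proof
      assume "t = pos_part n"
      then show ?thesis using k unfolding mn(4) lead[OF mn(1)] monomial_dvd_iff
        by (auto intro!: exI[of _ k])
    next
      assume "t = neg_part n"
      then show ?thesis using l unfolding mn(4) lead[OF mn(1)] monomial_dvd_iff
        by (auto intro!: exI[of _ l])
    qed
  qed auto
  have "ideal_gen H \<noteq> ?I" if H: "H \<subset> ?G" for H
  proof
    assume HI: "ideal_gen H = ?I"
    from psubset_imp_ex_mem[OF H]
    obtain m where m: "m \<in> U" "lattice_binomial m \<notin> H" by auto
    obtain Z where "((\<exists>k\<in>Z. m k > 0) \<noteq> (\<exists>k\<in>Z. m k < 0)) \<and>
      (\<forall>n\<in>U. n \<noteq> m \<longrightarrow> (\<exists>k\<in>Z. n k > 0) = (\<exists>k\<in>Z. n k < 0))"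
      using minimal[OF m(1)] by (rule exE)
    note Z = conjunct1[OF this] conjunct2[OF this, rule_format]
    \<comment> \<open>Evaluation at this point annihilates the binomials of all \<open>n\<close>
      other than \<open>m\<close>, hence the ideal of \<open>H\<close>, but not the binomial of
      \<open>m\<close>.\<close>
    define h :: "'n monomial \<Rightarrow> 'k" where "h t = (if \<exists>k\<in>Z. exponent t k > 0 then 0 else 1)" for t
    define R where "R p q \<longleftrightarrow> (\<exists>n\<in>U. n \<noteq> m \<and> p = pos_part n \<and> q = neg_part n)" for p q
    have "H \<subseteq> {xpow p - xpow q | p q. R p q}"
    proof
      fix x assume x: "x \<in> H"
      then have "x \<in> ?G" using psubset_imp_subset[OF H] by (rule rev_subsetD)
      then obtain n where n: "n \<in> U" "x = lattice_binomial n" by (rule imageE)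
      then have "n \<noteq> m" using x m(2) by blast
      then have "R (pos_part n) (neg_part n)" using n(1) unfolding R_def by blast
      then show "x \<in> {xpow p - xpow q | p q. R p q}" unfolding n(2) lattice_binomial_def by blast
    qed
    then have "ideal_gen H \<subseteq> ideal_gen {xpow p - xpow q | p q. R p q}" by (rule ideal_gen_mono)
    moreover have "lattice_binomial m \<in> ideal_gen H" unfolding HI by (rule inI[OF m(1)])
    ultimately have bm: "lattice_binomial m \<in> ideal_gen {xpow p - xpow q :: ('n, 'k) mpoly | p q. R p q}" by (rule subsetD)
    have "pairing h (lattice_binomial m) = 0"
    proof (rule pairing_ideal[OF bm])
      fix p q t assume "R p q"
      then obtain n where n: "n \<in> U" "n \<noteq> m" "p = pos_part n" "q = neg_part n" unfolding R_def by blast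
      have "(\<exists>k\<in>Z. exponent (t + p) k > 0) \<longleftrightarrow> (\<exists>k\<in>Z. exponent t k > 0) \<or> (\<exists>k\<in>Z. n k > 0)"
        "(\<exists>k\<in>Z. exponent (t + q) k > 0) \<longleftrightarrow> (\<exists>k\<in>Z. exponent t k > 0) \<or> (\<exists>k\<in>Z. n k < 0)"
        by (auto simp: n(3,4) lookup_add)
      then show "h (t + p) = h (t + q)" using Z(2)[OF n(1,2)] by (simp add: h_def)
    qed
    moreover have "pairing h (lattice_binomial m) = h (pos_part m) - h (neg_part m)"
      by (simp add: lattice_binomial_def pairing_diff xpow_def pairing_single)
    moreover have "h (pos_part m) = (if \<exists>k\<in>Z. m k > 0 then 0 else 1)"
      "h (neg_part m) = (if \<exists>k\<in>Z. m k < 0 then 0 else 1)"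
      by (simp_all add: h_def)
    ultimately show False
      using Z(1) by (cases "\<exists>k\<in>Z. m k > 0"; cases "\<exists>k\<in>Z. m k < 0") simp_all
  qed
  then have "minimal_generating_set ?G ?I" unfolding minimal_generating_set_def using IG by blast
  then show ?thesis using to sqf init rgb by blast
qed

section \<open>Groebner bases from frames\<close>

lemma toric_frame_swap: "toric_frame L i j F G \<Longrightarrow> toric_frame L j i G F"
  unfolding toric_frame_def by (auto simp: add.commute)

text \<open>The neighbouring chamber is spanned by the Gale vectors \<open>(1, -1)\<close> of
  \<open>p\<close> and \<open>(1, 0)\<close> of \<open>i\<close>, in which \<open>(x, y)\<close> has
  coordinates \<open>- y\<close> and \<open>x + y\<close>. The lower bound on \<open>G\<close> keeps
  the first of them at most 1.\<close>

lemma toric_frame_shear: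
  assumes fr: "toric_frame (relations A) i j F G" and p: "F p = 1" "G p = -1"
    and G: "\<And>k. G k \<ge> -1"
  shows "toric_frame (relations A) p i (\<lambda>k. - G k) (\<lambda>k. F k + G k)"
proof -
  have FG: "F \<in> relations A" "G \<in> relations A" "F i = 1" "F j = 0" "G i = 0" "G j = 1"
    and rep: "\<And>u k. u \<in> relations A \<Longrightarrow> u k = u i * F k + u j * G k"
    and le: "\<And>k. F k \<le> 1 \<and> G k \<le> 1 \<and> \<not> (F k = 1 \<and> G k = 1)"
    using fr unfolding toric_frame_def by blast+
  have "(\<lambda>k. 0 * F k + (-1) * G k) \<in> relations A" "(\<lambda>k. 1 * F k + 1 * G k) \<in> relations A"
    by (rule relations_comb[OF FG(1,2)])+
  then have L: "(\<lambda>k. - G k) \<in> relations A" "(\<lambda>k. F k + G k) \<in> relations A" by simp_all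
  have r: "u k = u p * - G k + u i * (F k + G k)" if u: "u \<in> relations A" for u k
  proof -
    have up: "u p = u i - u j" using rep[OF u, of p] p by simp
    show ?thesis unfolding up rep[OF u, of k] by (simp add: algebra_simps)
  qed
  have "- G k \<le> 1 \<and> F k + G k \<le> 1 \<and> \<not> (- G k = 1 \<and> F k + G k = 1)" for k
    using le[of k] G[of k] by linarith
  then show ?thesis unfolding toric_frame_def using L r p FG by auto
qed

context
  fixes A :: "int^'n::finite^'d::finite" and i j :: 'n and F G :: "'n \<Rightarrow> int"
  assumes fr: "toric_frame (relations A) i j F G"
begin

lemma frame_facts: "F \<in> relations A" "G \<in> relations A" "F i = 1" "F j = 0" "G i = 0" "G j = 1"
  and frame_rep: "\<And>u k. u \<in> relations A \<Longrightarrow> u k = u i * F k + u j * G k"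
  and frame_le: "\<And>k. F k \<le> 1" "\<And>k. G k \<le> 1" "\<And>k. \<not> (F k = 1 \<and> G k = 1)"
  using fr unfolding toric_frame_def by blast+

lemma frame_sign:
  assumes "u \<in> relations A" "u i + u j \<ge> 0" "u \<noteq> (\<lambda>_. 0)"
  shows "u i > 0 \<or> u j > 0"
proof (rule ccontr)
  assume "\<not> ?thesis"
  then have "u i = 0" "u j = 0" using assms(2) by linarith+
  then have "u k = 0" for k using frame_rep[OF assms(1), of k] by simp
  then show False using assms(3) by auto
qed

text \<open>Where \<open>F k\<close> is 1, the frame makes \<open>G k\<close> nonpositive, so
  \<open>u j\<close> contributes nothing negative and \<open>u k\<close> is at least
  \<open>u i\<close>.\<close>

lemma frame_cover_fst:
  assumes u: "u \<in> relations A" "u i > 0" "u j \<le> 0" and k: "F k > 0"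
  shows "u k > 0"
proof -
  have F: "F k = 1" using frame_le(1)[of k] k by linarith
  then have "G k \<le> 0" using frame_le(2,3)[of k] by linarith
  then have "u j * G k \<ge> 0" using u(3) by (simp add: mult_nonpos_nonpos)
  then show ?thesis using frame_rep[OF u(1), of k] u(2) F by simp
qed

text \<open>With \<open>(1, 1)\<close> excluded, a positive sum only comes from
  \<open>(1, 0)\<close> or \<open>(0, 1)\<close>, where \<open>u k\<close> is \<open>u i\<close> or
  \<open>u j\<close>.\<close>

lemma frame_cover_sum:
  assumes u: "u \<in> relations A" "u i > 0" "u j > 0" and k: "F k + G k > 0"
  shows "u k > 0"
proof -
  have "F k = 1 \<and> G k = 0 \<or> F k = 0 \<and> G k = 1" using frame_le[of k] k by linarith
  then show ?thesis using frame_rep[OF u(1), of k] u(2,3) by auto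
qed

text \<open>This supplies the 0/1 point showing that the binomials of \<open>G\<close> and
  \<open>F + G\<close> do not generate that of \<open>F\<close>: a zero at \<open>j\<close> kills
  their positive terms, and one at \<open>z\<close> their negative terms.\<close>

lemma frame_essential_fst:
  assumes p: "F p = 1" "G p < 0" and q: "F q < 0" "G q = 1"
    and z: "G z < 0" "\<not> (F z = 1 \<and> G z = -1)"
  shows "\<exists>Z. ((\<exists>k\<in>Z. F k > 0) \<noteq> (\<exists>k\<in>Z. F k < 0)) \<and> (\<exists>k\<in>Z. G k > 0) \<and> (\<exists>k\<in>Z. G k < 0) \<and>
    (\<exists>k\<in>Z. F k + G k > 0) \<and> (\<exists>k\<in>Z. F k + G k < 0)"
proof (cases "F z = 1")
  case False
  then have "F z \<le> 0" using frame_le(1)[of z] by linarith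
  \<comment> \<open>The positive term of \<open>F\<close> stays nonzero, and its negative term
    vanishes through \<open>q\<close>.\<close>
  let ?Z = "{k. F k \<noteq> 1}"
  have "\<not> (\<exists>k\<in>?Z. F k > 0)" using frame_le(1) by (force simp: order.order_iff_strict)
  moreover have "\<exists>k\<in>?Z. F k < 0" using q by (intro bexI[of _ q]) auto
  moreover have "\<exists>k\<in>?Z. G k > 0" "\<exists>k\<in>?Z. F k + G k > 0"
    using frame_facts by (auto intro!: exI[of _ j])
  moreover have "\<exists>k\<in>?Z. G k < 0" "\<exists>k\<in>?Z. F k + G k < 0"
    using z False \<open>F z \<le> 0\<close> by (auto intro!: exI[of _ z])
  ultimately show ?thesis by (intro exI[of _ ?Z]) blast
next
  case True
  then have Gz: "G z \<le> -2" using z by linarith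
  \<comment> \<open>Here the negative term of \<open>F\<close> stays nonzero;
    \<open>F z + G z\<close> is negative because \<open>G z\<close> is at most -2.\<close>
  let ?Z = "insert j {k. F k = 1 \<and> G k < 0}"
  have "\<exists>k\<in>?Z. F k > 0" using p by (auto intro!: exI[of _ p])
  moreover have "\<not> (\<exists>k\<in>?Z. F k < 0)" using frame_facts by auto
  moreover have "\<exists>k\<in>?Z. G k > 0" "\<exists>k\<in>?Z. F k + G k > 0"
    using frame_facts by auto
  moreover have "\<exists>k\<in>?Z. G k < 0" "\<exists>k\<in>?Z. F k + G k < 0"
    using z True Gz by (auto intro!: exI[of _ z])
  ultimately show ?thesis by (intro exI[of _ ?Z]) blast
qed

end

lemma groebner_complete_intersection:
  fixes A :: "int^'n::finite^'d::finite"
  assumes fr: "toric_frame (relations A) i j F G" and K: "\<And>k. F k = 1 \<Longrightarrow> G k = 0"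
  shows "\<exists>le. term_order le \<and>
    (\<exists>S. (\<forall>t\<in>S. squarefree_monomial t) \<and>
         initial_ideal le (toric_ideal A :: ('n, 'k::field) mpoly set) = ideal_gen (xpow ` S)) \<and>
    (\<exists>G. reduced_groebner_basis le (toric_ideal A :: ('n, 'k) mpoly set) G \<and>
         minimal_generating_set G (toric_ideal A))"
proof (rule toric_groebner_basis[of "{F, G}" A i j])
  note ff = frame_facts[OF fr] and fl = frame_le[OF fr]
  show "u i + u j > 0" if "u \<in> {F, G}" for u using that ff by auto
  show "u k \<le> 1" if "u \<in> {F, G}" for u k using that fl by auto
  show "\<exists>m\<in>{F, G}. \<forall>k. m k > 0 \<longrightarrow> u k > 0"
    if u: "u \<in> relations A" "u i + u j \<ge> 0" "u \<noteq> (\<lambda>_. 0)" for u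
  proof (cases "u i > 0")
    case True
    have "u k > 0" if "F k > 0" for k
    proof -
      have "F k = 1" using fl(1)[of k] that by linarith
      then show ?thesis using frame_rep[OF fr u(1), of k] K True by simp
    qed
    then show ?thesis by blast
  next
    case False
    then have "u j > 0" using frame_sign[OF fr u] by blast
    then have "u k > 0" if "G k > 0" for k
      using frame_cover_fst[OF toric_frame_swap[OF fr] u(1) _ _ that] False by simp
    then show ?thesis by blast
  qed
  show "(\<exists>k. m k > 0 \<and> n k \<le> 0) \<and> (\<exists>k. m k > 0 \<and> n k \<ge> 0)"
    if "m \<in> {F, G}" "n \<in> {F, G}" "m \<noteq> n" for m n
    using that ff by (auto intro: exI[of _ i] exI[of _ j])
  show "\<exists>Z. ((\<exists>k\<in>Z. m k > 0) \<noteq> (\<exists>k\<in>Z. m k < 0)) \<and>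
      (\<forall>n\<in>{F, G}. n \<noteq> m \<longrightarrow> (\<exists>k\<in>Z. n k > 0) = (\<exists>k\<in>Z. n k < 0))" if "m \<in> {F, G}" for m
  proof (cases "m = F")
    case True
    then show ?thesis using ff by (intro exI[of _ "{i}"]) auto
  next
    case False
    then show ?thesis using that ff by (intro exI[of _ "{j}"]) auto
  qed
qed (use frame_facts[OF fr] in auto)

text \<open>The indices \<open>p\<close> and \<open>q\<close> keep the leading monomials of
  \<open>F\<close> and \<open>G\<close> from dividing that of \<open>F + G\<close>; \<open>z\<close>
  and \<open>y\<close> make \<open>F\<close> and \<open>G\<close> indispensable as
  generators.\<close>

lemma groebner_three_generators:
  fixes A :: "int^'n::finite^'d::finite"
  assumes fr: "toric_frame (relations A) i j F G"
    and p: "F p = 1" "G p < 0" and q: "F q < 0" "G q = 1"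
    and z: "G z < 0" "\<not> (F z = 1 \<and> G z = -1)" and y: "F y < 0" "\<not> (G y = 1 \<and> F y = -1)"
  shows "\<exists>le. term_order le \<and>
    (\<exists>S. (\<forall>t\<in>S. squarefree_monomial t) \<and>
         initial_ideal le (toric_ideal A :: ('n, 'k::field) mpoly set) = ideal_gen (xpow ` S)) \<and>
    (\<exists>G. reduced_groebner_basis le (toric_ideal A :: ('n, 'k) mpoly set) G \<and>
         minimal_generating_set G (toric_ideal A))"
proof -
  define H where "H k = F k + G k" for k
  note ff = frame_facts[OF fr] and fl = frame_le[OF fr]
  have "(\<lambda>k. 1 * F k + 1 * G k) \<in> relations A" by (rule relations_comb[OF ff(1,2)])
  then have HL: "H \<in> relations A" by (simp add: H_def[abs_def])
  have Hz: "H z < 0" using z fl[of z] unfolding H_def by linarith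
  show ?thesis
  proof (rule toric_groebner_basis[of "{F, G, H}" A i j])
    show "u i + u j > 0" if "u \<in> {F, G, H}" for u using that ff by (auto simp: H_def)
    show "u k \<le> 1" if "u \<in> {F, G, H}" for u k
      using that fl[of k] unfolding H_def by (elim insertE) (auto simp: H_def)
    show "\<exists>m\<in>{F, G, H}. \<forall>k. m k > 0 \<longrightarrow> u k > 0"
      if u: "u \<in> relations A" "u i + u j \<ge> 0" "u \<noteq> (\<lambda>_. 0)" for u
    proof -
      consider "u i > 0" "u j > 0" | "u i > 0" "u j \<le> 0" | "u j > 0" "u i \<le> 0"
        using frame_sign[OF fr u] by linarith
      then show ?thesis
      proof cases
        case 1
        then show ?thesis using frame_cover_sum[OF fr u(1)] by (simp add: H_def)
      next
        case 2
        then show ?thesis using frame_cover_fst[OF fr u(1)] by simp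
      next
        case 3
        then show ?thesis using frame_cover_fst[OF toric_frame_swap[OF fr] u(1)] by simp
      qed
    qed
    have Hij: "H i = 1" "H j = 1" "H p \<le> 0" "H q \<le> 0" using ff p q by (simp_all add: H_def)
    show "(\<exists>k. m k > 0 \<and> n k \<le> 0) \<and> (\<exists>k. m k > 0 \<and> n k \<ge> 0)"
      if "m \<in> {F, G, H}" "n \<in> {F, G, H}" "m \<noteq> n" for m n
    proof -
      have "0 < F i \<and> G i \<le> 0 \<and> G i \<ge> 0" "0 < G j \<and> F j \<le> 0 \<and> F j \<ge> 0"
        "0 < F p \<and> H p \<le> 0" "0 < F i \<and> H i \<ge> 0" "0 < G q \<and> H q \<le> 0" "0 < G j \<and> H j \<ge> 0"
        "0 < H j \<and> F j \<le> 0 \<and> F j \<ge> 0" "0 < H i \<and> G i \<le> 0 \<and> G i \<ge> 0"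
        using ff p q Hij by auto
      then show ?thesis using that by (elim insertE emptyE) blast+
    qed
    show "\<exists>Z. ((\<exists>k\<in>Z. m k > 0) \<noteq> (\<exists>k\<in>Z. m k < 0)) \<and>
      (\<forall>n\<in>{F, G, H}. n \<noteq> m \<longrightarrow> (\<exists>k\<in>Z. n k > 0) = (\<exists>k\<in>Z. n k < 0))" if m: "m \<in> {F, G, H}" for m
    proof -
      consider "m = F" | "m = G" | "m = H" using m by blast
      then show ?thesis
      proof cases
        case 1
        obtain Z where "(\<exists>k\<in>Z. F k > 0) \<noteq> (\<exists>k\<in>Z. F k < 0)" "\<exists>k\<in>Z. G k > 0" "\<exists>k\<in>Z. G k < 0"
          "\<exists>k\<in>Z. H k > 0" "\<exists>k\<in>Z. H k < 0"
          using frame_essential_fst[OF fr p q z] unfolding H_def by blast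
        then show ?thesis unfolding 1 by (intro exI[of _ Z]) simp
      next
        case 2
        obtain Z where "(\<exists>k\<in>Z. G k > 0) \<noteq> (\<exists>k\<in>Z. G k < 0)" "\<exists>k\<in>Z. F k > 0" "\<exists>k\<in>Z. F k < 0"
          "\<exists>k\<in>Z. H k > 0" "\<exists>k\<in>Z. H k < 0"
          using frame_essential_fst[OF toric_frame_swap[OF fr] q(2,1) p(2,1) y]
          unfolding H_def add.commute[of "G _"] by blast
        then show ?thesis unfolding 2 by (intro exI[of _ Z]) simp
      next
        case 3
        \<comment> \<open>The positive term of \<open>H\<close> stays nonzero and \<open>z\<close>
          kills its negative term, while \<open>p\<close> and \<open>q\<close> kill both terms of
          the other two binomials.\<close>
        let ?Z = "{k. H k \<le> 0}"
        have "\<not> (\<exists>k\<in>?Z. H k > 0)" by auto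
        moreover have "\<exists>k\<in>?Z. H k < 0" using Hz by (intro bexI[of _ z]) auto
        moreover have "\<exists>k\<in>?Z. F k > 0" "\<exists>k\<in>?Z. G k < 0" using p Hij by (auto intro!: exI[of _ p])
        moreover have "\<exists>k\<in>?Z. F k < 0" "\<exists>k\<in>?Z. G k > 0" using q Hij by (auto intro!: exI[of _ q])
        ultimately show ?thesis unfolding 3 by (intro exI[of _ ?Z]) blast
      qed
    qed
  qed (use ff HL in auto)
qed

theorem theorem1:
  fixes A :: "int^'n::finite^'d::finite"
  assumes "\<And>i j. 0 \<le> A $ i $ j"
    and "rank (map_matrix real_of_int A) = CARD('d)"
    and "CARD('n) = CARD('d) + 2"
    and "normal_matrix A"
  shows "\<exists>le. term_order le \<and>
    (\<exists>S. (\<forall>t\<in>S. squarefree_monomial t) \<and>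
         initial_ideal le (toric_ideal A :: ('n, 'k::field) mpoly set) = ideal_gen (xpow ` S)) \<and>
    (\<exists>G. reduced_groebner_basis le (toric_ideal A :: ('n, 'k) mpoly set) G \<and>
         minimal_generating_set G (toric_ideal A))"
proof -
  obtain i j F G where fr: "toric_frame (relations A) i j F G"
    using toric_frame_exists[OF assms] by blast
  note fl = frame_le[OF fr]
  \<comment> \<open>If \<open>G\<close> is negative only at Gale vectors \<open>(1, -1)\<close>,
    then \<open>F + G\<close> vanishes wherever \<open>- G\<close> is 1, so in the sheared frame two
    binomials suffice.\<close>
  have sheared: ?thesis
    if fr: "toric_frame (relations A) i j F G" and p: "F p = 1" "G p < 0"
      and neg: "\<And>z. G z < 0 \<Longrightarrow> F z = 1 \<and> G z = -1" for i j p F G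
  proof (rule groebner_complete_intersection[OF toric_frame_shear[OF fr p(1)]])
    show "G p = -1" using neg[OF p(2)] by simp
    show "G k \<ge> -1" for k using neg[of k] by (cases "G k < 0") auto
    show "F k + G k = 0" if "- G k = 1" for k using neg[of k] that by simp
  qed
  show ?thesis
  proof (cases "(\<exists>p. F p = 1 \<and> G p < 0) \<and> (\<exists>q. F q < 0 \<and> G q = 1)")
    case False
    \<comment> \<open>Without \<open>p\<close> the frame bounds force \<open>G\<close> to vanish
      wherever \<open>F\<close> is 1; without \<open>q\<close> the roles are exchanged.\<close>
    then have "(\<forall>k. F k = 1 \<longrightarrow> G k = 0) \<or> (\<forall>k. G k = 1 \<longrightarrow> F k = 0)"
      using fl by (smt (verit))
    then show ?thesis
      using groebner_complete_intersection[OF fr]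
        groebner_complete_intersection[OF toric_frame_swap[OF fr]] by blast
  next
    case True
    then obtain p q where p: "F p = 1" "G p < 0" and q: "F q < 0" "G q = 1" by blast
    show ?thesis
    proof (cases "\<forall>z. G z < 0 \<longrightarrow> F z = 1 \<and> G z = -1")
      case True
      then show ?thesis using sheared[OF fr p] by blast
    next
      case z: False
      show ?thesis
      proof (cases "\<forall>y. F y < 0 \<longrightarrow> G y = 1 \<and> F y = -1")
        case True
        then show ?thesis using sheared[OF toric_frame_swap[OF fr] q(2,1)] by blast
      next
        case False
        then show ?thesis using groebner_three_generators[OF fr p q] z by blast
      qed
    qed
  qed
qed

end
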